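(* Let $G$ be a graph embedded in a closed orientable surface $F$ of genus $g\geq 1$. Let $\ell_0$ be the set of homologically trivial loops in $G$, let $k=|\ell_0|$ and $n=|V(G)|-c(G)$, where $c(G)$ is the number of connected components of $G$. Let $\mu$ and $\lambda$ be the invariants of $G$ defined from the reduced graph $G'$ (see context). Then $P_G(X,Y,U,V)$ has the following coefficients: $$\mu\,V^gX^{n-1}Y^k+\lambda\,V^{g-1}X^nY^k,$$ that is, the coefficient of the monomial $V^gX^{n-1}Y^k$ (with $U$-exponent $0$) in $P_G$ is $\mu$, and the coefficient of the monomial $V^{g-1}X^nY^k$ (with $U$-exponent $0$) in $P_G$ is $\lambda$.
   Context: Krushkal polynomial. For a subsurface $S\subset F$, its genus is the genus of the closed surface obtained by capping off all boundary components of $S$ by disks. For a spanning subgraph $H$ of $G$ (all vertices, any subset of edges), let $\mathcal H$ be the regular neighborhood of $H$ on $F$ and let $i\colon H\to F$ be the embedding. Define $c(H)$ = number of components of $H$; $s(H)$ = twice the genus of $\mathcal H$; $s^\perp(H)$ = twice the genus of $F-\mathcal H$; $k(H)=\dim\ker(i_*\colon H_1(H;\mathbb R)\to H_1(F;\mathbb R))$. The Krushkal polynomial is $$p_G(x,y,u,v)=\sum_{H\subset G}x^{c(H)-c(G)}y^{k(H)}u^{s(H)/2}v^{s^\perp(H)/2},$$ the sum being over all spanning subgraphs $H$ of $G$, and $P_G(X,Y,U,V)=p_G(X-1,Y-1,U,V)$. Reduced graph. Two edges of $G$ are parallel if they are homologous on $F$: non-loop edges are parallel if they have the same endpoints and together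 form a null-homologous 2-cycle; loops are parallel if, with suitable orientations, they are homologous in $F$ (parallel loops may be disjoint). The reduced graph $G'=(V,E')$ of $G=(V,E)$ is obtained by deleting all but one edge in each set of parallel edges and deleting all homologically trivial loops, keeping $V(G')=V(G)$. Let $\ell$ be the subgraph (set) of loops in $G'$ and $G'-\ell=(V,E'-\ell)$. Define $$\mu=b_1(G'-\ell)=|E'-\ell|-|V|+c(G'),\qquad \lambda=|\ell|.$$ Although $G'$ is not uniquely determined, $\mu$ and $\lambda$ depend only on $G\subset F$. *)

theory Defs
  imports
    "HOL-Analysis.Analysis"
    "HOL-Combinatorics.Orbits"
    "HOL-Library.Poly_Mapping"
begin

section \<open>Closed oriented surfaces with a cell structure\<close>

text \<open>
  A closed connected oriented surface is given by a cell decomposition, encoded as a combinatorial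
  map on a finite type of darts (oriented edges). The dart \<open>flip F d\<close> is \<open>d\<close> reversed, and
  \<open>rot F d\<close> is the clockwise next dart with the same tail as \<open>d\<close>. An edge is a pair
  \<open>{d, flip F d}\<close>, a vertex is an orbit of \<open>rot F\<close> (the darts that leave it), and a face is an
  orbit of \<open>rot F \<circ> flip F\<close> (the darts that have it on their left).

  Every graph (tamely) embedded in a closed connected oriented surface of positive genus is a
  subcomplex of such a decomposition: cut the complementary regions into disks by further vertices
  and edges. A graph on the surface is therefore a set of vertices and a set of edges of the
  decomposition. It need not be connected or cellularly embedded, and it may have loops, multiple
  edges and isolated vertices.
\<close>

record 'd surface =
  rot :: "'d \<Rightarrow> 'd"
  flip :: "'d \<Rightarrow> 'd"

definition closed_surface :: "('d::finite) surface \<Rightarrow> bool" where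
  "closed_surface F \<longleftrightarrow>
     bij (rot F) \<and> (\<forall>d. flip F (flip F d) = d \<and> flip F d \<noteq> d) \<and>
     (\<forall>d d'. (d, d') \<in> ({(x, rot F x) | x. True} \<union> {(x, flip F x) | x. True})\<^sup>*)"

definition vertex_at :: "'d surface \<Rightarrow> 'd \<Rightarrow> 'd set" where
  "vertex_at F d = orbit (rot F) d"

definition edge_at :: "'d surface \<Rightarrow> 'd \<Rightarrow> 'd set" where
  "edge_at F d = {d, flip F d}"

definition face_at :: "'d surface \<Rightarrow> 'd \<Rightarrow> 'd set" where
  "face_at F d = orbit (rot F \<circ> flip F) d"

definition embedded_graph :: "'d surface \<Rightarrow> 'd set set \<Rightarrow> 'd set set \<Rightarrow> bool" where
  "embedded_graph F V E \<longleftrightarrow>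
     V \<subseteq> range (vertex_at F) \<and> E \<subseteq> range (edge_at F) \<and>
     (\<forall>d. edge_at F d \<in> E \<longrightarrow> vertex_at F d \<in> V)"

definition num_components :: "'a set \<Rightarrow> ('a \<times> 'a) set \<Rightarrow> nat" where
  "num_components A r =
     card (A // {(x, y). x \<in> A \<and> y \<in> A \<and> (x, y) \<in> ((r \<union> r\<inverse>) \<inter> A \<times> A)\<^sup>*})"

definition graph_components :: "'d surface \<Rightarrow> 'd set set \<Rightarrow> 'd set set \<Rightarrow> nat" where
  "graph_components F V E =
     num_components V {(vertex_at F d, vertex_at F (flip F d)) | d. edge_at F d \<in> E}"

section \<open>Subsurfaces and their genus\<close>

text \<open>
  Thickening the cells (a vertex to a disk, an edge to a band, and what remains of a face is a disk)
  turns the decomposition into a tiling of the surface in which exactly three tiles meet at every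
  corner, namely one vertex, one edge and one face tile. Hence the union of any set of tiles is a
  compact subsurface with boundary. The regular neighbourhood of a subgraph is the union of the
  tiles of its vertices and edges, and its complement is the union of the other tiles.

  Every dart \<open>d\<close> contributes two corners, to the left \<open>(d, True)\<close> and to the right \<open>(d, False)\<close> of
  the end of its band at its tail, and three sides of tiles: \<open>VE d\<close>, the end of the band at the tail
  of \<open>d\<close>; \<open>EF d\<close>, the long side of the band on the left of \<open>d\<close>; and \<open>VF d\<close>, the arc of the vertex
  disk between the band of \<open>d\<close> and the band of its clockwise successor.
\<close>

datatype 'd tile = Vertex "'d set" | Edge "'d set" | Face "'d set"

datatype 'd side = VE 'd | EF 'd | VF 'd

definition tiles :: "'d surface \<Rightarrow> 'd tile set" where
  "tiles F = range (Vertex \<circ> vertex_at F) \<union> range (Edge \<circ> edge_at F) \<union> range (Face \<circ> face_at F)"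

fun tiles_at_side :: "'d surface \<Rightarrow> 'd side \<Rightarrow> 'd tile set" where
  "tiles_at_side F (VE d) = {Vertex (vertex_at F d), Edge (edge_at F d)}"
| "tiles_at_side F (EF d) = {Edge (edge_at F d), Face (face_at F d)}"
| "tiles_at_side F (VF d) = {Vertex (vertex_at F d), Face (face_at F (flip F d))}"

fun tiles_at_corner :: "'d surface \<Rightarrow> 'd \<times> bool \<Rightarrow> 'd tile set" where
  "tiles_at_corner F (d, left) =
     {Vertex (vertex_at F d), Edge (edge_at F d), Face (face_at F (if left then d else flip F d))}"

fun side_ends :: "'d surface \<Rightarrow> 'd side \<Rightarrow> ('d \<times> bool) set" where
  "side_ends F (VE d) = {(d, True), (d, False)}"
| "side_ends F (EF d) = {(d, True), (flip F d, False)}"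
| "side_ends F (VF d) = {(d, False), (rot F d, True)}"

definition tile_components :: "'d surface \<Rightarrow> 'd tile set \<Rightarrow> nat" where
  "tile_components F S = num_components S {(t, t'). \<exists>s. tiles_at_side F s = {t, t'}}"

definition euler_char :: "'d surface \<Rightarrow> 'd tile set \<Rightarrow> int" where
  "euler_char F S =
     int (card {c. tiles_at_corner F c \<inter> S \<noteq> {}}) -
     int (card {s. tiles_at_side F s \<inter> S \<noteq> {}}) + int (card S)"

definition boundary_sides :: "'d surface \<Rightarrow> 'd tile set \<Rightarrow> 'd side set" where
  "boundary_sides F S = {s. tiles_at_side F s \<inter> S \<noteq> {} \<and> \<not> tiles_at_side F s \<subseteq> S}"

definition boundary_circles :: "'d surface \<Rightarrow> 'd tile set \<Rightarrow> nat" where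
  "boundary_circles F S =
     num_components (boundary_sides F S) {(s, s'). side_ends F s \<inter> side_ends F s' \<noteq> {}}"

text \<open>
  Capping off the boundary circles by disks raises the Euler characteristic by their number. A closed
  oriented surface with \<open>c\<close> components and total genus \<open>h\<close> has Euler characteristic \<open>2 * c - 2 * h\<close>,
  so the division by 2 is exact.
\<close>

definition capped_euler_char :: "'d surface \<Rightarrow> 'd tile set \<Rightarrow> int" where
  "capped_euler_char F S = euler_char F S + int (boundary_circles F S)"

definition genus :: "'d surface \<Rightarrow> 'd tile set \<Rightarrow> nat" where
  "genus F S = nat ((2 * int (tile_components F S) - capped_euler_char F S) div 2)"

definition regular_nbhd :: "'d set set \<Rightarrow> 'd set set \<Rightarrow> 'd tile set" where
  "regular_nbhd V E = Vertex ` V \<union> Edge ` E"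

section \<open>First homology with real coefficients\<close>

text \<open>
  Cellular chains: a 1-chain is a function \<open>z\<close> of darts with \<open>z (flip d) = - z d\<close>, and a 2-chain is
  a function \<open>w\<close> of faces. The boundary of \<open>z\<close> takes a vertex to minus the sum of \<open>z\<close> over the darts
  that leave it. The group \<open>H\<^sub>1\<close> of a subgraph is its space of cycles, as it has no 2-cells.
\<close>

definition cycles :: "('d::finite) surface \<Rightarrow> 'd set set \<Rightarrow> (real ^ 'd) set" where
  "cycles F E =
     {z. (\<forall>d. z $ flip F d = - (z $ d)) \<and> (\<forall>d. edge_at F d \<notin> E \<longrightarrow> z $ d = 0) \<and>
         (\<forall>d. (\<Sum>x \<in> vertex_at F d. z $ x) = 0)}"

definition boundaries :: "('d::finite) surface \<Rightarrow> (real ^ 'd) set" where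
  "boundaries F = range (\<lambda>w. \<chi> d. w (face_at F d) - w (face_at F (flip F d)))"

definition homologous :: "('d::finite) surface \<Rightarrow> real ^ 'd \<Rightarrow> real ^ 'd \<Rightarrow> bool" where
  "homologous F z z' \<longleftrightarrow> z - z' \<in> boundaries F"

definition ker_dim :: "('d::finite) surface \<Rightarrow> 'd set set \<Rightarrow> nat" where
  "ker_dim F E = dim {z \<in> cycles F E. homologous F z 0}"

definition dart_chain :: "('d::finite) surface \<Rightarrow> 'd \<Rightarrow> real ^ 'd" where
  "dart_chain F d = axis d 1 - axis (flip F d) 1"

section \<open>The Krushkal polynomial\<close>

text \<open>The exponents of \<open>u\<close> and \<open>v\<close> are half of twice a genus. The sum is over spanning subgraphs.\<close>

definition krushkal ::
  "('d::finite) surface \<Rightarrow> 'd set set \<Rightarrow> 'd set set \<Rightarrow> 'r \<Rightarrow> 'r \<Rightarrow> 'r \<Rightarrow> 'r \<Rightarrow> 'r::comm_ring_1" where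
  "krushkal F V E x y u v =
     (\<Sum>A \<in> Pow E.
        x ^ (graph_components F V A - graph_components F V E) * y ^ ker_dim F A *
        u ^ genus F (regular_nbhd V A) * v ^ genus F (tiles F - regular_nbhd V A))"

text \<open>
  Polynomials in four indeterminates, as finitely supported functions of the exponents. The
  exponents are integers (Laurent polynomials), so that a coefficient at a negative exponent is
  meaningful (it is 0 for a polynomial).
\<close>

type_synonym laurent4 = "(int \<times> int \<times> int \<times> int) \<Rightarrow>\<^sub>0 int"

definition mono_XYUV :: "int \<Rightarrow> int \<Rightarrow> int \<Rightarrow> int \<Rightarrow> laurent4" where
  "mono_XYUV i j a b = Poly_Mapping.single (i, j, a, b) 1"

definition coeff_XYUV :: "laurent4 \<Rightarrow> int \<Rightarrow> int \<Rightarrow> int \<Rightarrow> int \<Rightarrow> int" where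
  "coeff_XYUV P i j a b = Poly_Mapping.lookup P (i, j, a, b)"

definition krushkal_P :: "('d::finite) surface \<Rightarrow> 'd set set \<Rightarrow> 'd set set \<Rightarrow> laurent4" where
  "krushkal_P F V E =
     krushkal F V E (mono_XYUV 1 0 0 0 - 1) (mono_XYUV 0 1 0 0 - 1)
       (mono_XYUV 0 0 1 0) (mono_XYUV 0 0 0 1)"

section \<open>The reduced graph\<close>

definition loops :: "'d surface \<Rightarrow> 'd set set \<Rightarrow> 'd set set" where
  "loops F E = {edge_at F d | d. edge_at F d \<in> E \<and> vertex_at F d = vertex_at F (flip F d)}"

definition trivial_loops :: "('d::finite) surface \<Rightarrow> 'd set set \<Rightarrow> 'd set set" where
  "trivial_loops F E = {edge_at F d | d. edge_at F d \<in> loops F E \<and> homologous F (dart_chain F d) 0}"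

text \<open>The darts \<open>d\<close> and \<open>d'\<close> are the orientations under which the two edges are compared.\<close>

definition parallel :: "('d::finite) surface \<Rightarrow> 'd set \<Rightarrow> 'd set \<Rightarrow> bool" where
  "parallel F e e' \<longleftrightarrow>
     (\<exists>d d'. e = edge_at F d \<and> e' = edge_at F d' \<and>
        homologous F (dart_chain F d) (dart_chain F d') \<and>
        (if vertex_at F d = vertex_at F (flip F d)
         then vertex_at F d' = vertex_at F (flip F d')
         else vertex_at F d' = vertex_at F d \<and> vertex_at F (flip F d') = vertex_at F (flip F d)))"

text \<open>\<open>E'\<close> is the edge set of one of the possible reduced graphs of \<open>(V, E)\<close>.\<close>

definition reduced_edges :: "('d::finite) surface \<Rightarrow> 'd set set \<Rightarrow> 'd set set \<Rightarrow> bool" where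
  "reduced_edges F E E' \<longleftrightarrow>
     E' \<subseteq> E - trivial_loops F E \<and>
     (\<forall>e \<in> E - trivial_loops F E. \<exists>!e'. e' \<in> E' \<and> parallel F e e')"

definition mu :: "'d surface \<Rightarrow> 'd set set \<Rightarrow> 'd set set \<Rightarrow> int" where
  "mu F V E' = int (card (E' - loops F E')) - int (card V) + int (graph_components F V E')"

definition lambda :: "'d surface \<Rightarrow> 'd set set \<Rightarrow> int" where
  "lambda F E' = int (card (loops F E'))"

end

theory Submission
  imports Defs "HOL-Computational_Algebra.Polynomial"
begin

text \<open>
  Let \<open>H\<close> be a spanning subgraph with edge set \<open>A\<close>, let \<open>r\<close> be the rank of
  \<open>H\<^sub>1(H) \<rightarrow> H\<^sub>1(F)\<close>, and write \<open>s\<close> and \<open>s'\<close> for twice the genus of its neighbourhood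
  and of the complement. Chains that bound are functions on the components of the complement
  modulo constants, so the complement has \<open>k(H) + 1\<close> components; comparing Euler characteristics
  gives \<open>s' = s + 2 g - 2 r\<close>. Since \<open>s\<close> is even and \<open>0 \<le> s \<le> r\<close>, the exponents \<open>U\<^sup>0 V\<^sup>g\<close>
  and \<open>U\<^sup>0 V\<^bsup>g-1\<^esup>\<close> single out \<open>r = 0\<close> and \<open>r = 1\<close>.

  As every bounding chain is a cycle, \<open>r = \<rho>(A) - (|V| - c(H))\<close>, where \<open>\<rho>(A) = |A| - k(H)\<close> is the
  rank of \<open>A\<close> in the space of chains modulo boundaries. The powers of \<open>X\<close> then leave only
  \<open>\<rho>(A) \<le> 1\<close>. Here \<open>\<rho>(A) = 0\<close> means that \<open>A\<close> consists of trivial loops, and \<open>\<rho>(A) = 1\<close> that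
  \<open>A\<close> consists of trivial loops and a nonempty part of one parallel class. Each parallel class
  contributes 1 to its coefficient of \<open>Y\<^sup>k\<close>, and the sets of trivial loops contribute \<open>- n\<close> to the
  first coefficient through \<open>(X - 1)\<^sup>n\<close>.
\<close>

section \<open>Counting classes and orbits\<close>

text \<open>\<open>genus\<close> halves an integer and truncates it, so parity and nonnegativity
  have to be proved for the neighbourhood and for its complement. Both come from a permutation of
  the darts whose cycles are the boundary circles: adding an edge composes it with a transposition,
  which changes the number of cycles by exactly one. The complement is covered by the same lemma for
  the dual map, which has the same boundary permutation. For this, components on both sides and
  boundary circles are all counted as classes of relations on the one set of darts; vertices outside
  \<open>V\<close> add the same surplus \<open>outer\<close> where they occur, and it cancels. The
  bound s \<le> r is a semimodular inequality between such counts. Rank over the reals only makes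
  two edges proportional modulo boundaries, while parallel edges need the factor 1 or -1; an
  indicator function on faces closes this gap. The size of a parallel class disappears because the
  sum of (Y - 1)^(|M| - 1) over its nonempty subsets M has constant term 1 for every size.\<close>

definition ecl :: "('a \<times> 'a) set \<Rightarrow> ('a \<times> 'a) set" where
  "ecl R = (R \<union> R\<inverse>)\<^sup>*"

definition classes :: "('a \<times> 'a) set \<Rightarrow> nat" where
  "classes R = card (UNIV // ecl R)"

lemma ecl_refl [simp, intro]: "(x, x) \<in> ecl R"
  by (simp add: ecl_def)

lemma ecl_sym: "(x, y) \<in> ecl R \<Longrightarrow> (y, x) \<in> ecl R"
  unfolding ecl_def by (metis Un_commute converse_Un converse_converse rtrancl_converseI)

lemma ecl_trans: "(x, y) \<in> ecl R \<Longrightarrow> (y, z) \<in> ecl R \<Longrightarrow> (x, z) \<in> ecl R"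
  unfolding ecl_def by (rule rtrancl_trans)

lemma ecl_base: "(x, y) \<in> R \<Longrightarrow> (x, y) \<in> ecl R"
  unfolding ecl_def by auto

lemma equiv_ecl: "equiv UNIV (ecl R)"
  proof (rule equivI)
  show "refl (ecl R)" by (auto intro: refl_onI)
  show "sym (ecl R)" by (meson ecl_sym symI)
  show "trans (ecl R)" by (meson ecl_trans transI)
qed auto

lemma ecl_induct [consumes 1, case_names refl step]:
  assumes "(x, y) \<in> ecl R" "P x"
    and "\<And>y z. (x, y) \<in> ecl R \<Longrightarrow> P y \<Longrightarrow> (y, z) \<in> R \<or> (z, y) \<in> R \<Longrightarrow> P z"
  shows "P y"
  using assms(1) unfolding ecl_def
proof (induction rule: rtrancl_induct)
  case base
  then show ?case using assms(2) by simp
next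
  case (step y z)
  then show ?case using assms(3)[of y z] unfolding ecl_def by auto
qed

lemma ecl_least: "R \<subseteq> ecl S \<Longrightarrow> ecl R \<subseteq> ecl S"
proof clarify
  fix x y assume R: "R \<subseteq> ecl S" and "(x, y) \<in> ecl R"
  from this(2) show "(x, y) \<in> ecl S"
  proof (induction rule: ecl_induct)
    case (step y z)
    then show ?case using R by (meson ecl_sym ecl_trans subsetD)
  qed simp
qed

lemma ecl_mono: "R \<subseteq> S \<Longrightarrow> ecl R \<subseteq> ecl S"
  by (rule ecl_least) (auto intro: ecl_base)

lemma ecl_eqI: "R \<subseteq> ecl S \<Longrightarrow> S \<subseteq> ecl R \<Longrightarrow> ecl R = ecl S"
  by (simp add: ecl_least subset_antisym)

lemma ecl_invariant: "(x, y) \<in> ecl R \<Longrightarrow> (\<And>u v. (u, v) \<in> R \<Longrightarrow> h u = h v) \<Longrightarrow> h x = h y"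
  by (induction rule: ecl_induct) auto

text \<open>A new pair can only merge the class of \<open>a\<close> with that of \<open>b\<close>:
  their union enters as a full square and all other classes stay as they are.\<close>

lemma ecl_insert:
  "ecl (insert (a, b) R) =
     ecl R \<union> (ecl R `` {a} \<union> ecl R `` {b}) \<times> (ecl R `` {a} \<union> ecl R `` {b})" (is "?L = ?Q")
proof
  have base: "R \<subseteq> ecl (insert (a, b) R)" and ab: "(a, b) \<in> ecl (insert (a, b) R)"
    by (auto intro: ecl_base)
  have "ecl R \<subseteq> ?L" by (rule ecl_least[OF base])
  then show "?Q \<subseteq> ?L"
    using ab by (auto 0 0) (meson ecl_sym ecl_trans subsetD)+
  have *: "(x, y) \<in> ecl R \<or> ((a, x) \<in> ecl R \<or> (b, x) \<in> ecl R) \<and> ((a, y) \<in> ecl R \<or> (b, y) \<in> ecl R)"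
    if "(x, y) \<in> ?L" for x y
    using that
  proof (induction rule: ecl_induct)
    case (step y z)
    have "(y, z) \<in> ecl R \<or> y = a \<and> z = b \<or> y = b \<and> z = a"
      using step.hyps(2) ecl_base[of y z R] ecl_sym[OF ecl_base, of z y R] by (auto 0 0)
    then show ?case
    proof
      assume "(y, z) \<in> ecl R"
      then have "(w, y) \<in> ecl R \<Longrightarrow> (w, z) \<in> ecl R" for w by (rule ecl_trans[rotated])
      then show ?thesis using step.IH by blast
    next
      assume "y = a \<and> z = b \<or> y = b \<and> z = a"
      then have "(x, y) \<in> ecl R \<Longrightarrow> (a, x) \<in> ecl R \<or> (b, x) \<in> ecl R"
        "(a, z) \<in> ecl R \<or> (b, z) \<in> ecl R"
        by (auto dest: ecl_sym)
      then show ?thesis using step.IH by blast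
    qed
  qed simp
  show "?L \<subseteq> ?Q"
    using * by auto
qed

lemma ecl_insert_related: "(a, b) \<in> ecl R \<Longrightarrow> ecl (insert (a, b) R) = ecl R"
  by (rule ecl_eqI) (auto intro: ecl_base)

text \<open>Two distinct classes are replaced by their union, which is no old class since it
  contains both \<open>a\<close> and \<open>b\<close>. The successor form avoids truncated
  subtraction.\<close>

lemma classes_insert_unrelated:
  fixes R :: "('a::finite \<times> 'a) set"
  assumes "(a, b) \<notin> ecl R"
  shows "Suc (classes (insert (a, b) R)) = classes R"
proof -
  let ?Q = "ecl R"
  let ?a = "?Q `` {a}" and ?b = "?Q `` {b}"
  have cl: "?Q `` {x} = ?Q `` {y} \<longleftrightarrow> (x, y) \<in> ?Q" for x y
    using equiv_ecl[of R] by (simp add: eq_equiv_class_iff)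
  have ne: "?a \<noteq> ?b" using assms cl by blast
  have im: "ecl (insert (a, b) R) `` {x} =
      (if ?Q `` {x} = ?a \<or> ?Q `` {x} = ?b then ?a \<union> ?b else ?Q `` {x})" for x
  proof (cases "(x, a) \<in> ?Q \<or> (x, b) \<in> ?Q")
    case True
    then have "(a, x) \<in> ?Q \<or> (b, x) \<in> ?Q" by (meson ecl_sym)
    then have "?Q `` {x} \<subseteq> ?a \<union> ?b" by (auto 0 0) (meson ecl_trans)+
    then show ?thesis
      using True \<open>(a, x) \<in> ?Q \<or> (b, x) \<in> ?Q\<close> unfolding ecl_insert cl by auto
  next
    case False
    then have "(a, x) \<notin> ?Q" "(b, x) \<notin> ?Q" by (meson ecl_sym)+
    then show ?thesis using False unfolding ecl_insert cl by auto
  qed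
  have qR: "UNIV // ?Q = range (\<lambda>x. ?Q `` {x})" by (auto simp: quotient_def)
  have q: "UNIV // ecl (insert (a, b) R) = insert (?a \<union> ?b) (UNIV // ?Q - {?a, ?b})"
  proof -
    define h where "h x = ?Q `` {x}" for x
    have "UNIV // ecl (insert (a, b) R) = (\<lambda>x. if h x = h a \<or> h x = h b then h a \<union> h b else h x) ` UNIV"
      unfolding h_def im[symmetric] by (auto simp: quotient_def)
    also have "\<dots> = insert (h a \<union> h b) (range h - {h a, h b})" by auto
    finally show ?thesis unfolding qR h_def .
  qed
  have "?a \<union> ?b \<notin> UNIV // ?Q"
  proof
    assume "?a \<union> ?b \<in> UNIV // ?Q"
    then obtain x where x: "?a \<union> ?b = ?Q `` {x}" by (auto simp: quotient_def)
    have "a \<in> ?a \<union> ?b" "b \<in> ?a \<union> ?b" by auto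
    then have "(x, a) \<in> ?Q" "(x, b) \<in> ?Q" unfolding x by auto
    then show False using assms ecl_sym ecl_trans by metis
  qed
  moreover have "card (UNIV // ?Q - {?a, ?b}) = card (UNIV // ?Q) - 2"
  proof -
    have "{?a, ?b} \<subseteq> UNIV // ?Q" by (auto simp: quotient_def)
    then show ?thesis using ne by (simp add: card_Diff_subset card_2_iff)
  qed
  moreover have "card (UNIV // ?Q) \<ge> 2"
  proof -
    have "card {?a, ?b} \<le> card (UNIV // ?Q)"
      by (rule card_mono) (auto simp: quotient_def)
    then show ?thesis using ne by simp
  qed
  ultimately show ?thesis unfolding classes_def q by simp
qed

text \<open>Every class of the coarser relation is the saturation of a class of the finer one, so
  saturation is onto.\<close>

lemma classes_antimono:
  fixes R :: "('a::finite \<times> 'a) set"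
  assumes "ecl R \<subseteq> ecl S"
  shows "classes S \<le> classes R"
proof -
  have "UNIV // ecl S = (\<lambda>X. ecl S `` X) ` (UNIV // ecl R)"
  proof -
    have "ecl S `` (ecl R `` {x}) = ecl S `` {x}" for x
      using assms by (auto 0 0) (meson ecl_trans subsetD, blast)
    then show ?thesis by (simp add: quotient_def image_UN image_image UN_singleton)
  qed
  then show ?thesis unfolding classes_def by (simp add: card_image_le)
qed

text \<open>Submodularity of graphic rank: if the pairs of \<open>T\<close> are added one by one, a
  pair that merges two classes of the coarser relation also merges two classes of the finer one, so
  the finer relation loses at least as many.\<close>

lemma classes_semimodular:
  fixes R :: "('a::finite \<times> 'a) set"
  assumes "ecl R \<subseteq> ecl S"
  shows "classes S + classes (R \<union> T) \<le> classes R + classes (S \<union> T)"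
proof -
  have "finite T" by simp
  then show ?thesis
  proof (induction T)
    case (insert t T)
    obtain a b where t: "t = (a, b)" by (cases t)
    have sub: "ecl (R \<union> T) \<subseteq> ecl (S \<union> T)"
    proof (rule ecl_least)
      have "R \<subseteq> ecl S" using assms ecl_base by fastforce
      then show "R \<union> T \<subseteq> ecl (S \<union> T)"
        using ecl_mono[of S "S \<union> T"] by (auto intro: ecl_base)
    qed
    show ?case
    proof (cases "(a, b) \<in> ecl (S \<union> T)")
      case True
      then have "classes (S \<union> insert t T) = classes (S \<union> T)"
        unfolding classes_def t by (simp add: ecl_insert_related)
      moreover have "classes (R \<union> insert t T) \<le> classes (R \<union> T)"
        by (rule classes_antimono) (auto intro!: ecl_mono)
      ultimately show ?thesis using insert by simp
    next
      case False
      then have "(a, b) \<notin> ecl (R \<union> T)" using sub by blast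
      then show ?thesis
        using classes_insert_unrelated[of a b "R \<union> T"] classes_insert_unrelated[OF False] insert
        unfolding t by simp
    qed
  qed simp
qed

section \<open>Cycles of a permutation composed with a transposition\<close>

definition graph_of :: "('a \<Rightarrow> 'a) \<Rightarrow> ('a \<times> 'a) set" where
  "graph_of p = range (\<lambda>x. (x, p x))"

lemma graph_of_iff [simp]: "(x, y) \<in> graph_of p \<longleftrightarrow> y = p x"
  by (auto simp: graph_of_def)

text \<open>On a finite type an injection that maps \<open>S\<close> into itself maps it onto
  itself, so membership in \<open>S\<close> is invariant backwards along \<open>p\<close> as
  well.\<close>

lemma ecl_graph_closed:
  fixes p :: "'a::finite \<Rightarrow> 'a"
  assumes "inj p" "(a, b) \<in> ecl (graph_of p)" "a \<in> S" "p ` S \<subseteq> S"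
  shows "b \<in> S"
proof -
  have eq: "p ` S = S"
    by (metis assms(1,4) card_image card_subset_eq finite inj_on_subset subset_UNIV)
  have "p x \<in> S \<longleftrightarrow> x \<in> S" for x
    using assms(1) eq by (metis inj_image_mem_iff)
  then have "a \<in> S \<longleftrightarrow> b \<in> S"
    using ecl_invariant[OF assms(2), of "\<lambda>x. x \<in> S"] by auto
  then show ?thesis using assms(3) by simp
qed

lemma funpow_in_ecl: "(a, (p ^^ n) a) \<in> ecl (graph_of p)"
proof (induction n)
  case (Suc n)
  have "((p ^^ n) a, (p ^^ Suc n) a) \<in> ecl (graph_of p)" by (rule ecl_base) simp
  then show ?case using Suc ecl_trans by metis
qed simp

lemma ecl_graph_iff:
  fixes p :: "'a::finite \<Rightarrow> 'a"
  assumes "inj p"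
  shows "(a, b) \<in> ecl (graph_of p) \<longleftrightarrow> (\<exists>n. b = (p ^^ n) a)"
proof
  assume "(a, b) \<in> ecl (graph_of p)"
  then have "b \<in> range (\<lambda>n. (p ^^ n) a)"
    by (rule ecl_graph_closed[OF assms]) (auto intro: image_eqI[of _ _ 0] image_eqI[of _ _ "Suc _"])
  then show "\<exists>n. b = (p ^^ n) a" by auto
qed (auto intro: funpow_in_ecl)

lemma inj_funpow_return:
  fixes p :: "'a::finite \<Rightarrow> 'a"
  assumes "inj p"
  shows "\<exists>n>0. (p ^^ n) a = a"
proof -
  have "bij p" using assms finite_UNIV_inj_surj[OF finite_class.finite_UNIV assms] by (simp add: bij_def)
  then have "permutation p" by (simp add: permutation)
  from permutation_self[OF this, of a] show ?thesis by blast
qed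

lemma ecl_transpose: "(a, b) \<in> ecl R \<Longrightarrow> (x, Transposition.transpose a b x) \<in> ecl R"
  by (auto simp: Transposition.transpose_def intro: ecl_sym)

text \<open>Started at \<open>a\<close>, the new permutation follows the \<open>p\<close>-cycle of
  \<open>a\<close> until that would return to \<open>a\<close>, and is then diverted to
  \<open>b\<close>. Hence it relates \<open>a\<close> and \<open>b\<close>, and modulo this pair it
  agrees with \<open>p\<close>.\<close>

lemma transpose_merges:
  fixes p :: "'a::finite \<Rightarrow> 'a"
  assumes "inj p" "(a, b) \<notin> ecl (graph_of p)"
  shows "ecl (graph_of (Transposition.transpose a b \<circ> p)) = ecl (insert (a, b) (graph_of p))"
proof -
  let ?q = "Transposition.transpose a b \<circ> p"
  \<comment> \<open>The length of the cycle of \<open>p\<close> through \<open>a\<close>.\<close>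
  define m where "m = (LEAST n. n > 0 \<and> (p ^^ n) a = a)"
  have m: "m > 0" "(p ^^ m) a = a"
    using LeastI_ex[OF inj_funpow_return[OF assms(1), of a]] by (auto simp: m_def)
  have nb: "(p ^^ n) a \<noteq> b" for n using assms(2) funpow_in_ecl by metis
  have na: "(p ^^ n) a \<noteq> a" if "0 < n" "n < m" for n
    using not_less_Least that unfolding m_def by blast
  have pre: "(?q ^^ n) a = (p ^^ n) a" if "n < m" for n
    using that
  proof (induction n)
    case (Suc n)
    then show ?case using na[of "Suc n"] nb[of "Suc n"] by (simp add: Transposition.transpose_def)
  qed simp
  have "(?q ^^ m) a = b"
  proof -
    obtain m' where m': "m = Suc m'" using m(1) by (cases m) auto
    then have "(?q ^^ m) a = ?q ((p ^^ m') a)" using pre[of m'] by simp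
    also have "\<dots> = Transposition.transpose a b ((p ^^ m) a)" using m' by simp
    finally show ?thesis using m(2) by simp
  qed
  then have ab: "(a, b) \<in> ecl (graph_of ?q)" by (metis funpow_in_ecl)
  show ?thesis
  proof (rule ecl_eqI)
    show "graph_of ?q \<subseteq> ecl (insert (a, b) (graph_of p))"
    proof clarify
      fix x y assume "(x, y) \<in> graph_of ?q"
      then have y: "y = Transposition.transpose a b (p x)" by simp
      have "(x, p x) \<in> ecl (insert (a, b) (graph_of p))"
        "(a, b) \<in> ecl (insert (a, b) (graph_of p))" by (auto intro: ecl_base)
      then show "(x, y) \<in> ecl (insert (a, b) (graph_of p))"
        unfolding y by (rule ecl_trans[OF _ ecl_transpose])
    qed
    show "insert (a, b) (graph_of p) \<subseteq> ecl (graph_of ?q)"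
    proof clarify
      fix x y assume "(x, y) \<in> insert (a, b) (graph_of p)"
      then consider "(x, y) = (a, b)" | "y = p x" by auto
      then show "(x, y) \<in> ecl (graph_of ?q)"
      proof cases
        case 2
        have "(x, Transposition.transpose a b y) \<in> ecl (graph_of ?q)" unfolding 2 by (auto intro: ecl_base)
        moreover have "(Transposition.transpose a b y, y) \<in> ecl (graph_of ?q)"
          using ab by (intro ecl_sym[OF ecl_transpose])
        ultimately show ?thesis by (rule ecl_trans)
      qed (use ab in auto)
    qed
  qed
qed

text \<open>The stretch of the cycle from \<open>a\<close> to just before \<open>b\<close> closes
  up: its last point, which \<open>p\<close> sends to \<open>b\<close>, is now sent back to
  \<open>a\<close>. This stretch is invariant and misses \<open>b\<close>.\<close>

lemma transpose_splits:
  fixes p :: "'a::finite \<Rightarrow> 'a"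
  assumes "inj p" "(a, b) \<in> ecl (graph_of p)" "a \<noteq> b"
  shows "(a, b) \<notin> ecl (graph_of (Transposition.transpose a b \<circ> p))"
proof
  let ?q = "Transposition.transpose a b \<circ> p"
  assume ab: "(a, b) \<in> ecl (graph_of ?q)"
  define j where "j = (LEAST n. b = (p ^^ n) a)"
  have j: "b = (p ^^ j) a"
    unfolding j_def by (rule LeastI_ex[of "\<lambda>n. b = (p ^^ n) a"])
      (use assms(2) ecl_graph_iff[OF assms(1)] in simp)
  have nb: "(p ^^ n) a \<noteq> b" if "n < j" for n
    using not_less_Least[of n "\<lambda>n. b = (p ^^ n) a"] that unfolding j_def by auto
  let ?S = "(\<lambda>n. (p ^^ n) a) ` {..<j}"
  have "j > 0" using j assms(3) by (cases j) auto
  have "inj ?q" using assms(1) by (auto intro: inj_compose)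
  moreover have "a \<in> ?S" using \<open>j > 0\<close> by (auto intro: image_eqI[of _ _ 0])
  moreover have "?q ` ?S \<subseteq> ?S"
  proof clarify
    fix x n assume n: "n < j"
    show "?q ((p ^^ n) a) \<in> ?S"
    proof (cases "Suc n = j \<or> (p ^^ Suc n) a = a")
      case True
      then show ?thesis
      proof
        assume "Suc n = j"
        then have "?q ((p ^^ n) a) = a" using j by auto
        then show ?thesis using \<open>a \<in> ?S\<close> by simp
      next
        \<comment> \<open>A return to \<open>a\<close> on the way to \<open>b\<close> would give an
          earlier visit to \<open>b\<close>, against the choice of \<open>j\<close>.\<close>
        assume a: "(p ^^ Suc n) a = a"
        have "(p ^^ j) a = (p ^^ (j - Suc n)) ((p ^^ Suc n) a)"
          using n funpow_add[of "j - Suc n" "Suc n" p] by simp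
        then have "b = (p ^^ (j - Suc n)) a" using a j by simp
        then show ?thesis using nb[of "j - Suc n"] n by simp
      qed
    next
      case False
      then have "Suc n < j" using n by simp
      then have "?q ((p ^^ n) a) = (p ^^ Suc n) a"
        using nb[of "Suc n"] False by (simp add: Transposition.transpose_def)
      then show ?thesis using \<open>Suc n < j\<close> by (metis imageI lessThan_iff)
    qed
  qed
  ultimately have "b \<in> ?S" by (rule ecl_graph_closed[OF _ ab])
  then show False using nb by auto
qed

text \<open>Composing twice with the transposition gives \<open>p\<close> back, so the split is a
  merge read from the other side.\<close>

lemma classes_transpose:
  fixes p :: "'a::finite \<Rightarrow> 'a"
  assumes "inj p" "a \<noteq> b"
  shows "classes (graph_of (Transposition.transpose a b \<circ> p)) =
    (if (a, b) \<in> ecl (graph_of p) then Suc (classes (graph_of p)) else classes (graph_of p) - 1)"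
proof (cases "(a, b) \<in> ecl (graph_of p)")
  case False
  then show ?thesis
    using transpose_merges[OF assms(1) False] classes_insert_unrelated[OF False]
    by (simp add: classes_def)
next
  case True
  let ?q = "Transposition.transpose a b \<circ> p"
  have inj: "inj ?q" using assms(1) by (auto intro: inj_compose)
  have n: "(a, b) \<notin> ecl (graph_of ?q)" by (rule transpose_splits[OF assms(1) True assms(2)])
  have "Transposition.transpose a b \<circ> ?q = p" by (auto simp: fun_eq_iff)
  then have "ecl (graph_of p) = ecl (insert (a, b) (graph_of ?q))"
    using transpose_merges[OF inj n] by simp
  then show ?thesis using classes_insert_unrelated[OF n] True by (simp add: classes_def)
qed

section \<open>Parity and sign of twice the genus of a rotation system\<close>

definition flip_on :: "('a \<Rightarrow> 'a) \<Rightarrow> 'a set set \<Rightarrow> 'a \<Rightarrow> 'a" where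
  "flip_on f A x = (if {x, f x} \<in> A then f x else x)"

lemma inj_flip_on:
  assumes "\<And>x. f (f x) = x"
  shows "inj (flip_on f A)"
  by (rule inj_on_inverseI[of _ "flip_on f A"]) (simp add: flip_on_def assms insert_commute)

text \<open>\<open>G\<close> is 2c - V + E - F for the ribbon graph with rotation \<open>p\<close>
  and edge set \<open>A\<close>, whose boundary circles are the cycles of
  \<open>flip_on f A \<circ> p\<close>. A new edge leaves \<open>G\<close> unchanged if it splits a
  boundary cycle or joins two components, and raises it by 2 if it merges two boundary cycles within
  a component. As only a permutation and a fixed-point-free involution enter, the dual map is
  covered too.\<close>

lemma genus_even_nonneg:
  fixes p f :: "'a::finite \<Rightarrow> 'a"
  assumes p: "inj p" and f: "\<And>x. f (f x) = x" "\<And>x. f x \<noteq> x" and A: "A \<subseteq> range (\<lambda>x. {x, f x})"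
  defines "G \<equiv> 2 * int (classes (graph_of p \<union> graph_of (flip_on f A))) - int (classes (graph_of p))
      + int (card A) - int (classes (graph_of (flip_on f A \<circ> p)))"
  shows "even G \<and> G \<ge> 0"
proof -
  define G' where "G' A = 2 * int (classes (graph_of p \<union> graph_of (flip_on f A)))
      - int (classes (graph_of p)) + int (card A) - int (classes (graph_of (flip_on f A \<circ> p)))" for A
  have "finite A" by simp
  then have "even (G' A) \<and> G' A \<ge> 0" using A
  proof (induction A)
    case empty
    have "flip_on f {} = id" by (auto simp: flip_on_def)
    moreover have "ecl (graph_of p \<union> graph_of id) = ecl (graph_of p)"
      by (rule ecl_eqI) (auto intro: ecl_base)
    ultimately show ?case by (simp add: G'_def classes_def)
  next
    case (insert e A)
    then obtain a where e: "e = {a, f a}" by auto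
    let ?R = "graph_of p \<union> graph_of (flip_on f A)" and ?q = "flip_on f A \<circ> p"
    have e_iff: "{x, f x} = e \<longleftrightarrow> x = a \<or> x = f a" for x
      unfolding e using f by (metis doubleton_eq_iff)
    have A_a: "{a, f a} \<notin> A" "{f a, f (f a)} \<notin> A"
      using insert(2) f(1) unfolding e by (auto simp: insert_commute)
    \<comment> \<open>Switching on an edge swaps two darts that were fixed before.\<close>
    have fi: "flip_on f (insert e A) = Transposition.transpose a (f a) \<circ> flip_on f A"
    proof
      fix x
      consider "x = a" | "x = f a" | "x \<noteq> a" "x \<noteq> f a" by blast
      then show "flip_on f (insert e A) x = (Transposition.transpose a (f a) \<circ> flip_on f A) x"
      proof cases
        case 3
        moreover have "f x \<noteq> a" "f x \<noteq> f a" using 3 f by metis+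
        ultimately show ?thesis using e_iff[of x] by (simp add: flip_on_def Transposition.transpose_def)
      qed (use A_a e_iff f in \<open>auto simp: flip_on_def\<close>)
    qed
    have inj: "inj ?q"
      using inj_compose[OF inj_flip_on[of f A, OF f(1)] p] by simp
    have R: "ecl (graph_of p \<union> graph_of (flip_on f (insert e A))) = ecl (insert (a, f a) ?R)"
    proof (rule ecl_eqI)
      show "graph_of p \<union> graph_of (flip_on f (insert e A)) \<subseteq> ecl (insert (a, f a) ?R)"
      proof clarify
        fix x y assume "(x, y) \<in> graph_of p \<union> graph_of (flip_on f (insert e A))"
        then consider "(x, y) \<in> graph_of p" | "y = Transposition.transpose a (f a) (flip_on f A x)" by (auto simp: fi)
        then show "(x, y) \<in> ecl (insert (a, f a) ?R)"
        proof cases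
          case 2
          have "(x, flip_on f A x) \<in> ecl (insert (a, f a) ?R)"
            "(a, f a) \<in> ecl (insert (a, f a) ?R)" by (auto intro: ecl_base)
          then show ?thesis unfolding 2 by (rule ecl_trans[OF _ ecl_transpose])
        qed (auto intro: ecl_base)
      qed
      have "flip_on f (insert e A) x = flip_on f A x \<or> flip_on f A x = x" for x
        by (auto simp: flip_on_def)
      moreover have "flip_on f (insert e A) a = f a" by (simp add: flip_on_def e)
      ultimately show "insert (a, f a) ?R \<subseteq> ecl (graph_of p \<union> graph_of (flip_on f (insert e A)))"
        by (auto intro: ecl_base) (metis Un_iff ecl_base ecl_refl graph_of_iff)+
    qed
    \<comment> \<open>Boundary cycles stay within components, so an edge between two components
      joins two different cycles.\<close>
    have q: "ecl (graph_of ?q) \<subseteq> ecl ?R"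
    proof (rule ecl_least, clarify)
      fix x y assume "(x, y) \<in> graph_of ?q"
      then have "(x, p x) \<in> ecl ?R" "(p x, y) \<in> ecl ?R" by (auto intro: ecl_base)
      then show "(x, y) \<in> ecl ?R" by (rule ecl_trans)
    qed
    have cl: "classes (graph_of (flip_on f (insert e A) \<circ> p)) =
        (if (a, f a) \<in> ecl (graph_of ?q) then Suc (classes (graph_of ?q)) else classes (graph_of ?q) - 1)"
      using classes_transpose[OF inj, of a "f a"] f(2)[of a] by (simp add: fi comp_assoc)
    have pos: "classes (graph_of ?q) > 0"
      unfolding classes_def by (simp add: card_gt_0_iff quotient_def)
    show ?case
    proof (cases "(a, f a) \<in> ecl ?R")
      case True
      then have "classes (graph_of p \<union> graph_of (flip_on f (insert e A))) = classes ?R"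
        unfolding classes_def R by (simp add: ecl_insert_related)
      then show ?thesis using insert cl pos
        by (auto simp: G'_def of_nat_diff)
    next
      case False
      then have "(a, f a) \<notin> ecl (graph_of ?q)" using q by blast
      moreover have "Suc (classes (graph_of p \<union> graph_of (flip_on f (insert e A)))) = classes ?R"
        using classes_insert_unrelated[OF False] unfolding classes_def R by simp
      ultimately show ?thesis using insert cl pos
        by (auto simp: G'_def of_nat_diff)
    qed
  qed
  then show ?thesis unfolding G_def G'_def by simp
qed

section \<open>Components of a subsurface\<close>

definition connection :: "'a set \<Rightarrow> ('a \<times> 'a) set \<Rightarrow> ('a \<times> 'a) set" where
  "connection A r = {(x, y). x \<in> A \<and> y \<in> A \<and> (x, y) \<in> ((r \<union> r\<inverse>) \<inter> A \<times> A)\<^sup>*}"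

lemma num_components_eq: "num_components A r = card (A // connection A r)"
  by (simp add: num_components_def connection_def)

lemma connection_refl: "x \<in> A \<Longrightarrow> (x, x) \<in> connection A r"
  by (simp add: connection_def)

lemma connection_sym: "(x, y) \<in> connection A r \<Longrightarrow> (y, x) \<in> connection A r"
proof -
  have "sym ((r \<union> r\<inverse>) \<inter> A \<times> A)" by (auto intro: symI)
  then show "(x, y) \<in> connection A r \<Longrightarrow> (y, x) \<in> connection A r"
    unfolding connection_def by (auto dest: sym_rtrancl symD)
qed

lemma connection_trans:
  "(x, y) \<in> connection A r \<Longrightarrow> (y, z) \<in> connection A r \<Longrightarrow> (x, z) \<in> connection A r"
  unfolding connection_def by auto

lemma connection_base: "(x, y) \<in> r \<Longrightarrow> x \<in> A \<Longrightarrow> y \<in> A \<Longrightarrow> (x, y) \<in> connection A r"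
  unfolding connection_def by auto

lemma connection_invariant:
  assumes "(x, y) \<in> connection A r"
    and "\<And>u v. (u, v) \<in> r \<Longrightarrow> u \<in> A \<Longrightarrow> v \<in> A \<Longrightarrow> h u = h v"
  shows "h x = h y"
proof -
  have "(x, y) \<in> ((r \<union> r\<inverse>) \<inter> A \<times> A)\<^sup>*" using assms(1) by (simp add: connection_def)
  then show ?thesis
    by (induction rule: rtrancl_induct) (use assms(2) in fastforce)+
qed

lemma equiv_connection: "equiv A (connection A r)"
proof (rule equivI)
  show "refl_on A (connection A r)" by (auto intro: refl_onI connection_refl)
  show "sym (connection A r)" by (auto intro: symI connection_sym)
  show "trans (connection A r)" by (rule transI) (rule connection_trans)
qed (auto simp: connection_def)

lemma ecl_class_eq: "ecl R `` {x} = ecl R `` {y} \<longleftrightarrow> (x, y) \<in> ecl R"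
  using equiv_ecl[of R] by (simp add: eq_equiv_class_iff)

lemma card_image_cong:
  assumes "\<And>x y. x \<in> B \<Longrightarrow> y \<in> B \<Longrightarrow> f x = f y \<longleftrightarrow> g x = g y"
  shows "card (f ` B) = card (g ` B)"
proof -
  define h where "h z = g (inv_into B f z)" for z
  have h: "h (f x) = g x" if "x \<in> B" for x
    using assms[of "inv_into B f (f x)" x] that
    by (simp add: h_def inv_into_into f_inv_into_f)
  then have "inj_on h (f ` B)" using assms by (auto intro!: inj_onI)
  moreover have "h ` f ` B = g ` B" using h by (auto simp: image_iff)
  ultimately show ?thesis by (metis card_image)
qed

text \<open>The invariant \<open>\<psi>\<close> certifies that \<open>\<phi>\<close> does not identify different classes.\<close>

lemma num_components_transfer:
  assumes \<phi>: "\<And>x. x \<in> B \<Longrightarrow> \<phi> x \<in> A"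
    and closed: "\<And>x y. (x, y) \<in> R \<Longrightarrow> x \<in> B \<longleftrightarrow> y \<in> B"
    and R: "\<And>x y. (x, y) \<in> R \<Longrightarrow> x \<in> B \<Longrightarrow> (\<phi> x, \<phi> y) \<in> connection A r"
    and \<psi>: "\<And>a b. (a, b) \<in> r \<Longrightarrow> a \<in> A \<Longrightarrow> b \<in> A \<Longrightarrow> \<psi> a = \<psi> b"
    and \<psi>\<phi>: "\<And>x. x \<in> B \<Longrightarrow> \<psi> (\<phi> x) = ecl R `` {x}"
    and hit: "\<And>a. a \<in> A \<Longrightarrow> \<exists>x\<in>B. (a, \<phi> x) \<in> connection A r"
  shows "num_components A r = card (B // ecl R)"
proof -
  let ?Q = "connection A r"
  have B: "x \<in> B \<longleftrightarrow> y \<in> B" if "(x, y) \<in> ecl R" for x y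
    using ecl_invariant[OF that, of "\<lambda>x. x \<in> B"] closed by blast
  have fwd: "(\<phi> x, \<phi> y) \<in> ?Q" if "(x, y) \<in> ecl R" "x \<in> B" for x y
    using that
  proof (induction rule: ecl_induct)
    case refl
    then show ?case by (intro connection_refl \<phi>)
  next
    case (step y z)
    have y: "y \<in> B" using B[OF step.hyps(1)] step.prems by simp
    from step.hyps(2) have "(\<phi> y, \<phi> z) \<in> ?Q"
    proof
      assume "(y, z) \<in> R"
      then show ?thesis using y by (rule R)
    next
      assume zy: "(z, y) \<in> R"
      then have "z \<in> B" using closed y by simp
      with zy show ?thesis by (intro connection_sym[OF R])
    qed
    with step.IH[OF step.prems] show ?case by (rule connection_trans)
  qed
  have iff: "(\<phi> x, \<phi> y) \<in> ?Q \<longleftrightarrow> (x, y) \<in> ecl R" if "x \<in> B" "y \<in> B" for x y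
  proof
    assume "(\<phi> x, \<phi> y) \<in> ?Q"
    then have "\<psi> (\<phi> x) = \<psi> (\<phi> y)" by (rule connection_invariant) (rule \<psi>)
    then show "(x, y) \<in> ecl R" by (simp add: \<psi>\<phi> that ecl_class_eq)
  qed (use fwd that in simp)
  have "A // ?Q = (\<lambda>x. ?Q `` {\<phi> x}) ` B"
  proof -
    have "?Q `` {a} \<in> (\<lambda>x. ?Q `` {\<phi> x}) ` B" if a: "a \<in> A" for a
    proof -
      obtain x where x: "x \<in> B" "(a, \<phi> x) \<in> ?Q" using hit[OF a] by auto
      then have "?Q `` {a} = ?Q `` {\<phi> x}" by (intro equiv_class_eq[OF equiv_connection])
      then show ?thesis using x(1) by simp
    qed
    then show ?thesis using \<phi> by (auto simp: quotient_def)
  qed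
  also have "card \<dots> = card ((\<lambda>x. ecl R `` {x}) ` B)"
    by (rule card_image_cong)
      (simp add: eq_equiv_class_iff[OF equiv_connection] \<phi> iff ecl_class_eq)
  also have "(\<lambda>x. ecl R `` {x}) ` B = B // ecl R" by (auto simp: quotient_def)
  finally show ?thesis by (simp add: num_components_eq)
qed

lemma classes_split:
  fixes R :: "('a::finite \<times> 'a) set"
  assumes "\<And>x y. (x, y) \<in> R \<Longrightarrow> x \<in> B \<longleftrightarrow> y \<in> B"
  shows "classes R = card (B // ecl R) + card ((- B) // ecl R)"
proof -
  have B: "x \<in> B \<longleftrightarrow> y \<in> B" if "(x, y) \<in> ecl R" for x y
    using ecl_invariant[OF that, of "\<lambda>x. x \<in> B"] assms by blast
  have "UNIV // ecl R = B // ecl R \<union> (- B) // ecl R" by (auto simp: quotient_def)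
  moreover have "B // ecl R \<inter> (- B) // ecl R = {}"
    using B by (auto simp: quotient_def ecl_class_eq)
  ultimately show ?thesis unfolding classes_def by (simp add: card_Un_disjoint)
qed

lemma ecl_map:
  assumes "(x, y) \<in> ecl R" "\<And>u v. (u, v) \<in> R \<Longrightarrow> (h u, h v) \<in> ecl S"
  shows "(h x, h y) \<in> ecl S"
  using assms(1)
proof (induction rule: ecl_induct)
  case (step y z)
  then have "(h y, h z) \<in> ecl S" using assms(2) ecl_sym by metis
  then show ?case by (rule ecl_trans[OF step.IH])
qed simp

text \<open>\<open>orbit\<close> collects iterates with positive exponent only; the return time of
  the cycle supplies the starting point.\<close>

lemma orbit_eq_class:
  fixes p :: "'a::finite \<Rightarrow> 'a"
  assumes "inj p"
  shows "orbit p x = ecl (graph_of p) `` {x}"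
proof -
  obtain n where n: "n > 0" "(p ^^ n) x = x" using inj_funpow_return[OF assms] by blast
  have "\<exists>m>0. (p ^^ k) x = (p ^^ m) x" for k
    using n by (intro exI[of _ "k + n"]) (simp add: funpow_add)
  then show ?thesis
    unfolding orbit_altdef by (fastforce simp: ecl_graph_iff[OF assms])
qed

lemma ecl_absorb: "ecl R \<subseteq> ecl S \<Longrightarrow> ecl S `` (ecl R `` {x}) = ecl S `` {x}"
  using ecl_trans[of x _ S] by auto

section \<open>Vertices, edges and faces of a surface in terms of darts\<close>

locale surface_map =
  fixes F :: "('d::finite) surface"
  assumes closed: "closed_surface F"
begin

text \<open>Classes of \<open>R_vert A\<close> are the components of the graph formed by all
  vertices and the edges in \<open>A\<close>. In \<open>R_face A\<close> a dart stands for the face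
  on its right, and edges outside \<open>A\<close> may be crossed, so the classes are the components
  of the complement. \<open>R_bd A\<close> walks along the boundary: a dart stands for the arc of
  the vertex disk clockwise after its band, and the band met next is followed along its long side if
  it lies in \<open>A\<close> and passed over at its end otherwise.\<close>

abbreviation "R_vert A \<equiv> graph_of (rot F) \<union> graph_of (flip_on (flip F) A)"
abbreviation "R_face A \<equiv> graph_of (flip F \<circ> rot F) \<union> graph_of (flip_on (flip F) (range (edge_at F) - A))"
abbreviation "R_bd A \<equiv> graph_of (flip_on (flip F) A \<circ> rot F)"

lemma flip_flip [simp]: "flip F (flip F d) = d"
  using closed by (simp add: closed_surface_def)

lemma flip_neq [simp]: "flip F d \<noteq> d"
  using closed by (simp add: closed_surface_def)

lemma inj_rot: "inj (rot F)"
  using closed by (simp add: closed_surface_def bij_is_inj)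

lemma inj_flip: "inj (flip F)"
  by (rule inj_on_inverseI[of _ "flip F"]) simp

lemma flip_eq_iff [simp]: "flip F d = flip F d' \<longleftrightarrow> d = d'"
  using inj_flip by (simp add: inj_eq)

lemma edge_at_eq_iff: "edge_at F d = edge_at F d' \<longleftrightarrow> d' = d \<or> d' = flip F d"
  unfolding edge_at_def doubleton_eq_iff by (metis flip_flip)

lemma edge_at_flip [simp]: "edge_at F (flip F d) = edge_at F d"
  by (simp add: edge_at_eq_iff)

lemma flip_on_edge: "flip_on (flip F) A d = (if edge_at F d \<in> A then flip F d else d)"
  by (simp add: flip_on_def edge_at_def)

lemma vertex_at_class: "vertex_at F d = ecl (graph_of (rot F)) `` {d}"
  unfolding vertex_at_def by (rule orbit_eq_class[OF inj_rot])

lemma face_at_class: "face_at F d = ecl (graph_of (rot F \<circ> flip F)) `` {d}"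
  unfolding face_at_def by (rule orbit_eq_class) (rule inj_compose[OF inj_rot inj_flip])

lemma vertex_at_eq_iff: "vertex_at F d = vertex_at F d' \<longleftrightarrow> (d, d') \<in> ecl (graph_of (rot F))"
  by (simp add: vertex_at_class ecl_class_eq)

lemma face_at_eq_iff: "face_at F d = face_at F d' \<longleftrightarrow> (d, d') \<in> ecl (graph_of (rot F \<circ> flip F))"
  by (simp add: face_at_class ecl_class_eq)

lemma vertex_at_rot [simp]: "vertex_at F (rot F d) = vertex_at F d"
  unfolding vertex_at_eq_iff by (rule ecl_sym, rule ecl_base) simp

lemma face_at_rot [simp]: "face_at F (rot F d) = face_at F (flip F d)"
  unfolding face_at_eq_iff by (rule ecl_sym, rule ecl_base) simp

lemma in_vertex_at_iff: "x \<in> vertex_at F d \<longleftrightarrow> vertex_at F x = vertex_at F d"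
  by (auto simp: vertex_at_class ecl_class_eq intro: ecl_sym)

lemma in_face_at_iff: "x \<in> face_at F d \<longleftrightarrow> face_at F x = face_at F d"
  by (auto simp: face_at_class ecl_class_eq intro: ecl_sym)

text \<open>\<open>flip F\<close> conjugates \<open>rot F \<circ> flip F\<close> to
  \<open>flip F \<circ> rot F\<close>, so the cycles of the latter are the faces on the right of the
  darts.\<close>

lemma face_at_flip_eq_iff:
  "face_at F (flip F d) = face_at F (flip F d') \<longleftrightarrow> (d, d') \<in> ecl (graph_of (flip F \<circ> rot F))"
proof
  assume "face_at F (flip F d) = face_at F (flip F d')"
  then have "(flip F d, flip F d') \<in> ecl (graph_of (rot F \<circ> flip F))"
    by (simp add: face_at_eq_iff)
  then have "(flip F (flip F d), flip F (flip F d')) \<in> ecl (graph_of (flip F \<circ> rot F))"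
    by (rule ecl_map) (auto intro: ecl_base)
  then show "(d, d') \<in> ecl (graph_of (flip F \<circ> rot F))" by simp
next
  assume "(d, d') \<in> ecl (graph_of (flip F \<circ> rot F))"
  then show "face_at F (flip F d) = face_at F (flip F d')"
    by (rule ecl_invariant) simp
qed

lemma connected: "(d, d') \<in> ecl (graph_of (rot F) \<union> graph_of (flip F))"
proof -
  have "(d, d') \<in> ({(x, rot F x) | x. True} \<union> {(x, flip F x) | x. True})\<^sup>*"
    using closed by (simp add: closed_surface_def)
  also have "\<dots> \<subseteq> ecl (graph_of (rot F) \<union> graph_of (flip F))"
    unfolding ecl_def by (rule rtrancl_mono) auto
  finally show ?thesis .
qed

lemma card_vertices: "card (range (vertex_at F)) = classes (graph_of (rot F))"
proof -
  have "range (vertex_at F) = UNIV // ecl (graph_of (rot F))"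
    by (auto simp: quotient_def vertex_at_class)
  then show ?thesis by (simp add: classes_def)
qed

lemma card_faces: "card (range (face_at F)) = classes (graph_of (flip F \<circ> rot F))"
proof -
  have "range (face_at F) = (\<lambda>d. face_at F (flip F d)) ` UNIV"
    by (metis (no_types, lifting) flip_flip image_eqI image_subsetI rangeI subset_antisym)
  also have "card \<dots> = card ((\<lambda>d. ecl (graph_of (flip F \<circ> rot F)) `` {d}) ` UNIV)"
    by (rule card_image_cong) (simp add: face_at_flip_eq_iff ecl_class_eq)
  also have "(\<lambda>d. ecl (graph_of (flip F \<circ> rot F)) `` {d}) ` UNIV = UNIV // ecl (graph_of (flip F \<circ> rot F))"
    by (auto simp: quotient_def)
  finally show ?thesis by (simp add: classes_def)
qed

lemma card_darts_on_edges:
  assumes "A \<subseteq> range (edge_at F)"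
  shows "card {d. edge_at F d \<in> A} = 2 * card A"
proof -
  have "{d. edge_at F d \<in> A} = \<Union> A"
  proof
    show "{d. edge_at F d \<in> A} \<subseteq> \<Union> A" by (auto simp: edge_at_def)
    show "\<Union> A \<subseteq> {d. edge_at F d \<in> A}"
    proof clarify
      fix x e assume "x \<in> e" "e \<in> A"
      moreover then obtain d where "e = edge_at F d" using assms by blast
      ultimately show "edge_at F x \<in> A" by (auto simp: edge_at_def[of F d])
    qed
  qed
  moreover have "2 * card A = card (\<Union> A)"
  proof (rule card_partition)
    fix c assume "c \<in> A"
    then obtain d where c: "c = edge_at F d" using assms by blast
    show "card c = 2" unfolding c edge_at_def by (simp add: flip_neq[of d, symmetric] del: flip_neq)
    fix c' assume "c' \<in> A" "c \<noteq> c'"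
    then obtain d' where c': "c' = edge_at F d'" using assms by blast
    have "edge_at F x = c" if "x \<in> c" for x using that c edge_at_eq_iff[of x d] by (auto simp: edge_at_def[of F d])
    moreover have "edge_at F x = c'" if "x \<in> c'" for x using that c' by (auto simp: edge_at_def[of F d'])
    ultimately show "c \<inter> c' = {}" using \<open>c \<noteq> c'\<close> by blast
  qed auto
  ultimately show ?thesis by simp
qed

end

lemma Image_doubleton: "R `` {a, b} = R `` {a} \<union> R `` {b}"
  by auto

context surface_map
begin

lemma R_vert_edge:
  assumes "edge_at F d \<in> A"
  shows "ecl (R_vert A) `` {flip F d} = ecl (R_vert A) `` {d}"
  unfolding ecl_class_eq by (rule ecl_sym, rule ecl_base) (simp add: flip_on_edge assms)

lemma R_vert_vertex_at: "ecl (R_vert A) `` vertex_at F d = ecl (R_vert A) `` {d}"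
  unfolding vertex_at_class by (rule ecl_absorb, rule ecl_mono) simp

lemma R_vert_edge_at:
  assumes "edge_at F d \<in> A"
  shows "ecl (R_vert A) `` edge_at F d = ecl (R_vert A) `` {d}"
  using R_vert_edge[OF assms] unfolding edge_at_def Image_doubleton by simp

lemma R_face_rot: "ecl (R_face A) `` {flip F (rot F d)} = ecl (R_face A) `` {d}"
  unfolding ecl_class_eq by (rule ecl_sym, rule ecl_base) simp

lemma R_face_edge:
  assumes "edge_at F d \<notin> A"
  shows "ecl (R_face A) `` {flip F d} = ecl (R_face A) `` {d}"
  unfolding ecl_class_eq by (rule ecl_sym, rule ecl_base) (simp add: flip_on_edge assms)

lemma R_face_edge_at:
  assumes "edge_at F d \<notin> A"
  shows "ecl (R_face A) `` edge_at F d = ecl (R_face A) `` {d}"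
  using R_face_edge[OF assms] unfolding edge_at_def Image_doubleton by simp

text \<open>A face consists of the darts with it on their left; reversing them gives the darts that
  stand for it in \<open>R_face A\<close>.\<close>

lemma R_face_face_at: "ecl (R_face A) `` (flip F ` face_at F d) = ecl (R_face A) `` {flip F d}"
proof -
  have "flip F ` face_at F d = ecl (graph_of (flip F \<circ> rot F)) `` {flip F d}"
  proof (rule set_eqI)
    fix x
    have "x \<in> flip F ` face_at F d \<longleftrightarrow> flip F x \<in> face_at F d"
      by (metis flip_flip image_iff)
    also have "\<dots> \<longleftrightarrow> face_at F (flip F (flip F d)) = face_at F (flip F x)"
      by (auto simp: in_face_at_iff)
    also have "\<dots> \<longleftrightarrow> x \<in> ecl (graph_of (flip F \<circ> rot F)) `` {flip F d}"
      unfolding face_at_flip_eq_iff by simp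
    finally show "x \<in> flip F ` face_at F d \<longleftrightarrow> x \<in> ecl (graph_of (flip F \<circ> rot F)) `` {flip F d}" .
  qed
  then show ?thesis by (simp only:) (rule ecl_absorb, rule ecl_mono, simp)
qed

end

section \<open>Tile components and boundary circles as classes of darts\<close>

locale embedded_subgraph = surface_map +
  fixes V A :: "'a set set"
  assumes embedded: "embedded_graph F V A"
begin

abbreviation "D_V \<equiv> {d. vertex_at F d \<in> V}"
abbreviation "N \<equiv> regular_nbhd V A"

lemma V_sub: "V \<subseteq> range (vertex_at F)" and A_sub: "A \<subseteq> range (edge_at F)"
  using embedded by (auto simp: embedded_graph_def)

lemma vertex_in: "edge_at F d \<in> A \<Longrightarrow> vertex_at F d \<in> V"
  using embedded by (simp add: embedded_graph_def)

lemma vertex_in_flip: "edge_at F d \<in> A \<Longrightarrow> vertex_at F (flip F d) \<in> V"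
  using vertex_in[of "flip F d"] by simp

lemma R_vert_closed: "(x, y) \<in> R_vert A \<Longrightarrow> x \<in> D_V \<longleftrightarrow> y \<in> D_V"
  by (auto simp: flip_on_edge vertex_in vertex_in_flip split: if_splits)

lemma R_bd_closed: "(x, y) \<in> R_bd A \<Longrightarrow> x \<in> D_V \<longleftrightarrow> y \<in> D_V"
  using vertex_in[of "rot F x"] vertex_in_flip[of "rot F x"]
  by (auto simp: flip_on_edge split: if_splits)

lemma N_simps [simp]:
  "Vertex v \<in> N \<longleftrightarrow> v \<in> V" "Edge e \<in> N \<longleftrightarrow> e \<in> A" "Face c \<notin> N"
  by (auto simp: regular_nbhd_def)

lemma tiles_simps [simp]:
  "Vertex v \<in> tiles F \<longleftrightarrow> v \<in> range (vertex_at F)"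
  "Edge e \<in> tiles F \<longleftrightarrow> e \<in> range (edge_at F)"
  "Face c \<in> tiles F \<longleftrightarrow> c \<in> range (face_at F)"
  by (auto simp: tiles_def)

abbreviation "adjacent_tiles \<equiv> {(t, t'). \<exists>s. tiles_at_side F s = {t, t'}}"

lemma adjacent_tiles:
  "(Vertex (vertex_at F d), Edge (edge_at F d)) \<in> adjacent_tiles"
  "(Edge (edge_at F d), Face (face_at F d)) \<in> adjacent_tiles"
  "(Vertex (vertex_at F d), Face (face_at F (flip F d))) \<in> adjacent_tiles"
  using tiles_at_side.simps[of F d] by blast+

text \<open>Every vertex of the decomposition has a dart, so isolated vertices of the subgraph are
  counted as well.\<close>

lemma graph_components_classes: "graph_components F V A = card (D_V // ecl (R_vert A))"
  unfolding graph_components_def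
proof (rule num_components_transfer[where \<phi> = "vertex_at F" and \<psi> = "\<lambda>v. ecl (R_vert A) `` v"])
  fix x y assume "(x, y) \<in> R_vert A" "x \<in> D_V"
  then consider "y = rot F x" | "edge_at F x \<in> A" "y = flip F x" | "y = x"
    by (auto simp: flip_on_edge split: if_splits)
  then show "(vertex_at F x, vertex_at F y) \<in>
      connection V {(vertex_at F d, vertex_at F (flip F d)) |d. edge_at F d \<in> A}"
  proof cases
    case 2
    show ?thesis unfolding 2(2)
      by (rule connection_base) (use 2(1) vertex_in vertex_in_flip in auto)
  qed (use \<open>x \<in> D_V\<close> connection_refl in auto)
next
  fix a b assume "(a, b) \<in> {(vertex_at F d, vertex_at F (flip F d)) |d. edge_at F d \<in> A}"
  then obtain d where "edge_at F d \<in> A" "a = vertex_at F d" "b = vertex_at F (flip F d)" by auto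
  then show "ecl (R_vert A) `` a = ecl (R_vert A) `` b"
    by (simp only: R_vert_vertex_at R_vert_edge)
next
  fix v assume "v \<in> V"
  moreover then obtain d where "v = vertex_at F d" using V_sub by auto
  ultimately show "\<exists>x\<in>D_V. (v, vertex_at F x) \<in>
      connection V {(vertex_at F d, vertex_at F (flip F d)) |d. edge_at F d \<in> A}"
    by (intro bexI[of _ d]) (auto intro: connection_refl)
qed (use R_vert_closed in \<open>simp_all only: R_vert_vertex_at mem_Collect_eq\<close>)

text \<open>Every band of the neighbourhood hangs on a vertex disk, so vertex tiles represent all
  components. The empty set at faces is a dummy value, as the neighbourhood has no face
  tiles.\<close>

lemma tile_components_nbhd: "tile_components F N = card (D_V // ecl (R_vert A))"
  unfolding tile_components_def
proof (rule num_components_transfer[where \<phi> = "\<lambda>d. Vertex (vertex_at F d)" and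
    \<psi> = "\<lambda>t. case t of Vertex v \<Rightarrow> ecl (R_vert A) `` v | Edge e \<Rightarrow> ecl (R_vert A) `` e | Face c \<Rightarrow> {}"])
  fix x y assume "(x, y) \<in> R_vert A" "x \<in> D_V"
  then consider "y = rot F x" | "edge_at F x \<in> A" "y = flip F x" | "y = x"
    by (auto simp: flip_on_edge split: if_splits)
  then show "(Vertex (vertex_at F x), Vertex (vertex_at F y)) \<in>
      connection N adjacent_tiles"
  proof cases
    case 2
    have "(Vertex (vertex_at F x), Edge (edge_at F x)) \<in>
        connection N adjacent_tiles"
      using 2(1) vertex_in by (intro connection_base adjacent_tiles) auto
    moreover have "(Vertex (vertex_at F (flip F x)), Edge (edge_at F x)) \<in>
        connection N adjacent_tiles"
      using 2(1) vertex_in_flip adjacent_tiles(1)[of "flip F x"] by (intro connection_base) auto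
    ultimately show ?thesis unfolding 2(2)
      by (rule connection_trans[OF _ connection_sym])
  qed (use \<open>x \<in> D_V\<close> in \<open>auto intro: connection_refl\<close>)
next
  fix a b assume "(a, b) \<in> adjacent_tiles" and ab: "a \<in> N" "b \<in> N"
  then obtain s where s: "tiles_at_side F s = {a, b}" by auto
  show "(case a of Vertex v \<Rightarrow> ecl (R_vert A) `` v | Edge e \<Rightarrow> ecl (R_vert A) `` e | Face c \<Rightarrow> {}) =
    (case b of Vertex v \<Rightarrow> ecl (R_vert A) `` v | Edge e \<Rightarrow> ecl (R_vert A) `` e | Face c \<Rightarrow> {})"
  proof (cases s)
    case (VE d)
    then have "{a, b} = {Vertex (vertex_at F d), Edge (edge_at F d)}" using s by simp
    moreover then have "edge_at F d \<in> A" using ab by (auto simp: doubleton_eq_iff)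
    ultimately show ?thesis
      by (auto simp: doubleton_eq_iff R_vert_vertex_at R_vert_edge_at)
  qed (use s ab in \<open>auto simp: doubleton_eq_iff\<close>)
next
  fix t assume t: "t \<in> N"
  show "\<exists>x\<in>D_V. (t, Vertex (vertex_at F x)) \<in> connection N adjacent_tiles"
  proof (cases t)
    case (Vertex v)
    then obtain d where "v = vertex_at F d" using t V_sub by auto
    then show ?thesis using t Vertex by (intro bexI[of _ d]) (auto intro: connection_refl)
  next
    case (Edge e)
    then obtain d where d: "e = edge_at F d" using t A_sub by auto
    then have "d \<in> D_V" using t Edge vertex_in by simp
    moreover have "(Vertex (vertex_at F d), t) \<in> connection N adjacent_tiles"
      unfolding Edge d using t Edge d \<open>d \<in> D_V\<close> by (intro connection_base adjacent_tiles) auto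
    ultimately show ?thesis using connection_sym[of "Vertex (vertex_at F d)" t] by (intro bexI[of _ d])
  qed (use t in auto)
qed (use R_vert_closed in \<open>simp_all add: R_vert_vertex_at\<close>)

text \<open>All face tiles lie in the complement and every other tile there touches one, so all
  darts take part.\<close>

lemma tile_components_complement: "tile_components F (tiles F - N) = classes (R_face A)"
  unfolding tile_components_def classes_def
proof (rule num_components_transfer[where \<phi> = "\<lambda>d. Face (face_at F (flip F d))" and
    \<psi> = "\<lambda>t. case t of Vertex v \<Rightarrow> ecl (R_face A) `` v | Edge e \<Rightarrow> ecl (R_face A) `` e
      | Face c \<Rightarrow> ecl (R_face A) `` (flip F ` c)"])
  let ?C = "connection (tiles F - N) adjacent_tiles"
  have edge_face: "(Edge (edge_at F d), Face (face_at F d)) \<in> ?C" if "edge_at F d \<notin> A" for d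
    using that by (intro connection_base adjacent_tiles) auto
  fix x y assume "(x, y) \<in> R_face A"
  then consider "y = flip F (rot F x)" | "edge_at F x \<notin> A" "y = flip F x" | "y = x"
    by (auto simp: flip_on_edge split: if_splits)
  then show "(Face (face_at F (flip F x)), Face (face_at F (flip F y))) \<in> ?C"
  proof cases
    case 2
    have "(Edge (edge_at F x), Face (face_at F (flip F x))) \<in> ?C"
      "(Edge (edge_at F x), Face (face_at F x)) \<in> ?C"
      using edge_face[of x] edge_face[of "flip F x"] 2(1) by simp_all
    then show ?thesis unfolding 2(2) flip_flip by (rule connection_trans[OF connection_sym])
  qed (auto intro: connection_refl)
next
  fix a b assume "(a, b) \<in> adjacent_tiles"
    and ab: "a \<in> tiles F - N" "b \<in> tiles F - N"
  then obtain s where s: "tiles_at_side F s = {a, b}" by auto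
  \<comment> \<open>No edge at a vertex outside \<open>V\<close> belongs to \<open>A\<close>, so a
    turn around the vertex crosses its edges one after the other and stays in one class.\<close>
  have vertex: "ecl (R_face A) `` vertex_at F d = ecl (R_face A) `` {d}" if d: "vertex_at F d \<notin> V" for d
  proof -
    have "ecl (R_face A) `` {(rot F ^^ n) d} = ecl (R_face A) `` {d} \<and> vertex_at F ((rot F ^^ n) d) = vertex_at F d" for n
    proof (induction n)
      case (Suc n)
      let ?u = "rot F ((rot F ^^ n) d)"
      have "vertex_at F ?u = vertex_at F d" using Suc by simp
      then have "edge_at F ?u \<notin> A" using d vertex_in by metis
      then have "ecl (R_face A) `` {?u} = ecl (R_face A) `` {flip F ?u}" by (rule R_face_edge[symmetric])
      also have "\<dots> = ecl (R_face A) `` {d}" unfolding R_face_rot using Suc by (rule conjunct1)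
      finally have "ecl (R_face A) `` {?u} = ecl (R_face A) `` {d}" .
      moreover have "(rot F ^^ Suc n) d = ?u" by simp
      ultimately show ?case using \<open>vertex_at F ?u = vertex_at F d\<close> by (simp only:)
    qed simp
    then have "ecl (R_face A) `` {x} = ecl (R_face A) `` {d}" if "x \<in> vertex_at F d" for x
      using that by (auto simp: vertex_at_class ecl_graph_iff[OF inj_rot])
    then have "(\<Union>x\<in>vertex_at F d. ecl (R_face A) `` {x}) = (\<Union>x\<in>vertex_at F d. ecl (R_face A) `` {d})"
      by (intro SUP_cong) simp_all
    moreover have "vertex_at F d \<noteq> {}" using in_vertex_at_iff[of d d] by blast
    ultimately show ?thesis unfolding Image_eq_UN[of _ "vertex_at F d"] UN_constant by simp
  qed
  show "(case a of Vertex v \<Rightarrow> ecl (R_face A) `` v | Edge e \<Rightarrow> ecl (R_face A) `` e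
      | Face c \<Rightarrow> ecl (R_face A) `` (flip F ` c)) =
    (case b of Vertex v \<Rightarrow> ecl (R_face A) `` v | Edge e \<Rightarrow> ecl (R_face A) `` e
      | Face c \<Rightarrow> ecl (R_face A) `` (flip F ` c))"
  proof (cases s)
    case (VE d)
    then have "{a, b} = {Vertex (vertex_at F d), Edge (edge_at F d)}" using s by simp
    moreover then have "edge_at F d \<notin> A" "vertex_at F d \<notin> V" using ab by (auto simp: doubleton_eq_iff)
    ultimately show ?thesis
      by (auto simp: doubleton_eq_iff vertex R_face_edge_at)
  next
    case (EF d)
    then have "{a, b} = {Edge (edge_at F d), Face (face_at F d)}" using s by simp
    moreover then have "edge_at F d \<notin> A" using ab by (auto simp: doubleton_eq_iff)
    ultimately show ?thesis
      by (auto simp: doubleton_eq_iff R_face_face_at R_face_edge_at R_face_edge)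
  next
    case (VF d)
    then have "{a, b} = {Vertex (vertex_at F d), Face (face_at F (flip F d))}" using s by simp
    moreover then have "vertex_at F d \<notin> V" using ab by (auto simp: doubleton_eq_iff)
    ultimately show ?thesis
      by (auto simp: doubleton_eq_iff R_face_face_at vertex)
  qed
next
  let ?C = "connection (tiles F - N) adjacent_tiles"
  fix t assume t: "t \<in> tiles F - N"
  show "\<exists>x\<in>UNIV. (t, Face (face_at F (flip F x))) \<in> ?C"
  proof (cases t)
    case (Vertex v)
    then obtain d where d: "v = vertex_at F d" using t by auto
    have "(t, Face (face_at F (flip F d))) \<in> ?C"
      unfolding Vertex d using t Vertex d by (intro connection_base adjacent_tiles) auto
    then show ?thesis by (intro bexI[of _ d] UNIV_I)
  next
    case (Edge e)
    then obtain d where d: "e = edge_at F d" using t by auto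
    have "(t, Face (face_at F (flip F (flip F d)))) \<in> ?C"
      unfolding Edge d flip_flip using t Edge d by (intro connection_base adjacent_tiles) auto
    then show ?thesis by (intro bexI[of _ "flip F d"] UNIV_I) simp
  next
    case (Face c)
    then obtain d where d: "c = face_at F (flip F (flip F d))" using t by auto
    then show ?thesis using t Face by (intro bexI[of _ "flip F d"]) (auto intro: connection_refl)
  qed
next
  show "\<And>x y. (x, y) \<in> R_face A \<Longrightarrow> (x \<in> UNIV) = (y \<in> UNIV)" by simp
  fix x
  show "Face (face_at F (flip F x)) \<in> tiles F - N" by simp
  show "(case Face (face_at F (flip F x)) of Vertex v \<Rightarrow> ecl (R_face A) `` v | Edge e \<Rightarrow> ecl (R_face A) `` e
      | Face c \<Rightarrow> ecl (R_face A) `` (flip F ` c)) = ecl (R_face A) `` {x}"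
    using R_face_face_at[of A "flip F x"] by (simp only: tile.case flip_flip)
qed

lemma boundary_sides_nbhd:
  "boundary_sides F N = VE ` {d. vertex_at F d \<in> V \<and> edge_at F d \<notin> A} \<union>
     EF ` {d. edge_at F d \<in> A} \<union> VF ` D_V"
proof (rule set_eqI)
  fix s
  show "s \<in> boundary_sides F N \<longleftrightarrow> s \<in> VE ` {d. vertex_at F d \<in> V \<and> edge_at F d \<notin> A} \<union>
     EF ` {d. edge_at F d \<in> A} \<union> VF ` D_V"
    by (cases s) (auto simp: boundary_sides_def vertex_in)
qed

text \<open>Every boundary circle contains arcs \<open>VF d\<close>, and between consecutive arcs
  lies one further side: the long side of a band in \<open>A\<close>, or the end of an absent band.
  One such move is one step of \<open>R_bd A\<close>.\<close>

lemma boundary_circles_nbhd: "boundary_circles F N = card (D_V // ecl (R_bd A))"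
  unfolding boundary_circles_def
proof (rule num_components_transfer[where \<phi> = VF and
    \<psi> = "\<lambda>s. case s of VF d \<Rightarrow> ecl (R_bd A) `` {d} | EF d \<Rightarrow> ecl (R_bd A) `` {flip F d}
      | VE d \<Rightarrow> ecl (R_bd A) `` {d}"])
  let ?C = "connection (boundary_sides F N) {(s, s'). side_ends F s \<inter> side_ends F s' \<noteq> {}}"
  fix x y assume "(x, y) \<in> R_bd A" and x: "x \<in> D_V"
  then consider "edge_at F (rot F x) \<in> A" "y = flip F (rot F x)" | "edge_at F (rot F x) \<notin> A" "y = rot F x"
    by (auto simp: flip_on_edge split: if_splits)
  then show "(VF x, VF y) \<in> ?C"
  proof cases
    case 1
    have "(VF x, EF (rot F x)) \<in> ?C" "(EF (rot F x), VF y) \<in> ?C"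
      by (rule connection_base; use 1 x vertex_in_flip in \<open>force simp: boundary_sides_nbhd\<close>)+
    then show ?thesis by (rule connection_trans)
  next
    case 2
    have "(VF x, VE (rot F x)) \<in> ?C" "(VE (rot F x), VF y) \<in> ?C"
      by (rule connection_base; use 2 x in \<open>force simp: boundary_sides_nbhd\<close>)+
    then show ?thesis by (rule connection_trans)
  qed
next
  define cl where "cl x = ecl (R_bd A) `` {x}" for x
  \<comment> \<open>A label of corners that agrees with the label of each boundary side ending
    there. The right corner of a dart starts its own arc; the left corner ends the preceding arc,
    whose successor is \<open>flip_on (flip F) A\<close> of the dart.\<close>
  define at_corner where "at_corner c = cl (if snd c then flip_on (flip F) A (fst c) else fst c)" for c
  have bd: "cl (flip_on (flip F) A (rot F d)) = cl d" for d
    unfolding ecl_class_eq cl_def by (rule ecl_sym, rule ecl_base) simp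
  have *: "(case s of VF d \<Rightarrow> cl d | EF d \<Rightarrow> cl (flip F d) | VE d \<Rightarrow> cl d) = at_corner c"
    if "s \<in> boundary_sides F N" "c \<in> side_ends F s" for s c
  proof (cases s)
    case (VF d)
    then show ?thesis using that bd by (auto simp: at_corner_def)
  qed (use that in \<open>auto simp: boundary_sides_nbhd at_corner_def flip_on_edge\<close>)
  fix s s' assume "(s, s') \<in> {(s, s'). side_ends F s \<inter> side_ends F s' \<noteq> {}}"
    and s: "s \<in> boundary_sides F N" "s' \<in> boundary_sides F N"
  then obtain c where "c \<in> side_ends F s" "c \<in> side_ends F s'" by auto
  with *[OF s(1)] *[OF s(2)]
  show "(case s of VF d \<Rightarrow> ecl (R_bd A) `` {d} | EF d \<Rightarrow> ecl (R_bd A) `` {flip F d}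
      | VE d \<Rightarrow> ecl (R_bd A) `` {d}) = (case s' of VF d \<Rightarrow> ecl (R_bd A) `` {d}
      | EF d \<Rightarrow> ecl (R_bd A) `` {flip F d} | VE d \<Rightarrow> ecl (R_bd A) `` {d})"
    unfolding cl_def by simp
next
  let ?C = "connection (boundary_sides F N) {(s, s'). side_ends F s \<inter> side_ends F s' \<noteq> {}}"
  fix s assume s: "s \<in> boundary_sides F N"
  show "\<exists>x\<in>D_V. (s, VF x) \<in> ?C"
  proof (cases s)
    case (VE d)
    then have "vertex_at F d \<in> V" using s by (auto simp: boundary_sides_nbhd)
    moreover then have "(s, VF d) \<in> ?C" using s VE
      by (intro connection_base) (auto simp: boundary_sides_nbhd)
    ultimately show ?thesis by blast
  next
    case (EF d)
    then have "edge_at F d \<in> A" using s by (auto simp: boundary_sides_nbhd)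
    then have "vertex_at F (flip F d) \<in> V" by (rule vertex_in_flip)
    moreover then have "(s, VF (flip F d)) \<in> ?C" using s EF
      by (intro connection_base) (auto simp: boundary_sides_nbhd)
    ultimately show ?thesis by blast
  next
    case (VF d)
    then show ?thesis using s by (intro bexI[of _ d]) (auto simp: boundary_sides_nbhd intro: connection_refl)
  qed
next
  show "\<And>x. x \<in> D_V \<Longrightarrow> VF x \<in> boundary_sides F N" by (simp add: boundary_sides_nbhd)
  show "\<And>x y. (x, y) \<in> R_bd A \<Longrightarrow> (x \<in> D_V) = (y \<in> D_V)" by (rule R_bd_closed)
qed simp

end

section \<open>The kernel on homology\<close>

lemma classes_eq_1:
  assumes "\<And>x y. (x, y) \<in> ecl R"
  shows "classes R = 1"
proof -
  have "UNIV // ecl R = {UNIV}" using assms by (auto simp: quotient_def)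
  then show ?thesis by (simp add: classes_def)
qed

text \<open>The indicators of the classes are an orthogonal basis of the functions constant on
  classes; the normalization at \<open>d0\<close> removes the class of \<open>d0\<close>.\<close>

lemma dim_class_functions:
  fixes R :: "('d::finite \<times> 'd) set" and d0 :: 'd
  shows "Suc (dim {u :: real ^ 'd. (\<forall>x y. (x, y) \<in> ecl R \<longrightarrow> u $ x = u $ y) \<and> u $ d0 = 0}) = classes R"
    (is "Suc (dim ?W) = _")
proof -
  let ?cl = "\<lambda>x. ecl R `` {x}"
  define \<C> where "\<C> = UNIV // ecl R - {?cl d0}"
  define ind :: "'d set \<Rightarrow> real ^ 'd" where "ind X = (\<chi> d. of_bool (d \<in> X))" for X
  have in_class: "d \<in> X \<longleftrightarrow> X = ?cl d" if "X \<in> UNIV // ecl R" for d X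
  proof -
    obtain x where "X = ?cl x" using \<open>X \<in> UNIV // ecl R\<close> by (auto simp: quotient_def)
    then show ?thesis by (simp add: ecl_class_eq)
  qed
  have ne: "X \<noteq> {}" if "X \<in> \<C>" for X using that by (auto simp: \<C>_def quotient_def)
  have inj: "inj ind" unfolding ind_def by (rule injI) (simp add: vec_eq_iff of_bool_eq_iff set_eq_iff)
  have "dim ?W = card (ind ` \<C>)"
  proof (rule dim_unique[of "ind ` \<C>"])
    show "ind ` \<C> \<subseteq> ?W"
    proof clarify
      fix X assume "X \<in> \<C>"
      then have X: "X \<in> UNIV // ecl R" "X \<noteq> ?cl d0" by (auto simp: \<C>_def)
      have "ind X $ x = ind X $ y" if "(x, y) \<in> ecl R" for x y
        using that in_class[OF X(1)] by (simp add: ind_def ecl_class_eq[symmetric])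
      moreover have "ind X $ d0 = 0" using X in_class by (simp add: ind_def)
      ultimately show "(\<forall>x y. (x, y) \<in> ecl R \<longrightarrow> ind X $ x = ind X $ y) \<and> ind X $ d0 = 0" by simp
    qed
    show "?W \<subseteq> span (ind ` \<C>)"
    proof clarify
      fix u :: "real ^ 'd" assume u: "\<forall>x y. (x, y) \<in> ecl R \<longrightarrow> u $ x = u $ y" "u $ d0 = 0"
      define rep :: "'d set \<Rightarrow> 'd" where "rep X = (SOME d. d \<in> X)" for X
      have "u = (\<Sum>X\<in>\<C>. u $ rep X *\<^sub>R ind X)"
      proof (rule vec_eq_iff[THEN iffD2], rule allI)
        fix d
        have "(\<Sum>X\<in>\<C>. u $ rep X *\<^sub>R ind X) $ d =
            (\<Sum>X\<in>\<C>. if X = ?cl d then u $ rep X else 0)"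
          unfolding sum_component
          by (rule sum.cong) (use in_class in \<open>auto simp: ind_def \<C>_def\<close>)
        also have "\<dots> = (if ?cl d \<in> \<C> then u $ rep (?cl d) else 0)"
          by (simp add: sum.delta)
        also have "\<dots> = u $ d"
        proof (cases "?cl d = ?cl d0")
          case True
          then have "(d, d0) \<in> ecl R" by (simp add: ecl_class_eq)
          then have "u $ d = 0" using u by metis
          then show ?thesis using True by (simp add: \<C>_def)
        next
          case False
          then have "?cl d \<in> \<C>" by (auto simp: \<C>_def quotient_def)
          moreover have "rep (?cl d) \<in> ?cl d" unfolding rep_def by (rule someI[of _ d]) simp
          ultimately show ?thesis using u(1) by simp
        qed
        finally show "u $ d = (\<Sum>X\<in>\<C>. u $ rep X *\<^sub>R ind X) $ d" by simp
      qed
      then show "u \<in> span (ind ` \<C>)"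
        by (metis (no_types, lifting) span_sum span_scale span_base imageI)
    qed
    show "independent (ind ` \<C>)"
    proof (rule pairwise_orthogonal_independent)
      show "pairwise orthogonal (ind ` \<C>)"
      proof (rule pairwise_imageI)
        fix X Y assume "X \<in> \<C>" "Y \<in> \<C>" "X \<noteq> Y"
        then have "of_bool (d \<in> X) * of_bool (d \<in> Y) = (0 :: real)" for d
          using in_class by (auto simp: \<C>_def)
        then show "orthogonal (ind X) (ind Y)"
          by (simp add: orthogonal_def inner_vec_def ind_def)
      qed
      show "0 \<notin> ind ` \<C>" using ne by (auto simp: ind_def vec_eq_iff)
    qed
  qed simp
  also have "\<dots> = card \<C>" using inj by (simp add: card_image inj_on_subset)
  finally have "dim ?W = card \<C>" .
  moreover have "?cl d0 \<in> UNIV // ecl R" by (auto simp: quotient_def)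
  then have "Suc (card \<C>) = classes R" unfolding \<C>_def classes_def by (intro card_Suc_Diff1) simp
  ultimately show ?thesis by simp
qed

context surface_map
begin

lemma boundaries_iff:
  "z \<in> boundaries F \<longleftrightarrow> (\<exists>w. \<forall>d. z $ d = w (face_at F d) - w (face_at F (flip F d)))"
  by (auto simp: boundaries_def vec_eq_iff)

text \<open>The sum telescopes: the face on the right of a dart is the face on the left of its
  clockwise successor, and \<open>rot F\<close> permutes the darts at a vertex.\<close>

lemma boundary_is_cycle:
  assumes "z \<in> boundaries F"
  shows "(\<Sum>x \<in> vertex_at F d. z $ x) = 0"
proof -
  obtain w where w: "\<And>d. z $ d = w (face_at F d) - w (face_at F (flip F d))"
    using assms boundaries_iff by auto
  have "bij_betw (rot F) (vertex_at F d) (vertex_at F d)"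
  proof -
    have "inj_on (rot F) (vertex_at F d)" using inj_rot inj_on_subset by blast
    moreover have "rot F ` vertex_at F d \<subseteq> vertex_at F d" by (auto simp: in_vertex_at_iff)
    ultimately show ?thesis by (simp add: bij_betw_def card_image endo_inj_surj)
  qed
  then have "(\<Sum>x\<in>vertex_at F d. w (face_at F x)) = (\<Sum>x\<in>vertex_at F d. w (face_at F (rot F x)))"
    by (intro sum.reindex_bij_betw[symmetric])
  then show ?thesis by (simp add: w sum_subtractf)
qed

lemma boundary_antisym:
  assumes "z \<in> boundaries F"
  shows "z $ flip F d = - (z $ d)"
  using assms by (auto simp: boundaries_def)

lemma kernel_eq:
  "{z \<in> cycles F A. homologous F z 0} = {z \<in> boundaries F. \<forall>d. edge_at F d \<notin> A \<longrightarrow> z $ d = 0}"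
  using boundary_is_cycle boundary_antisym by (auto simp: cycles_def homologous_def)

text \<open>A boundary supported on \<open>A\<close> is the difference across edges of a function on
  faces that does not jump at edges outside \<open>A\<close>, hence of a function on the components
  of the complement. As the surface is connected, this function is unique up to a constant, which
  accounts for the successor and is fixed by the value 0 at an arbitrary dart.\<close>

lemma ker_dim_classes: "Suc (ker_dim F A) = classes (R_face A)"
proof -
  define d0 :: 'd where "d0 = undefined"
  let ?W = "{u :: real ^ 'd. (\<forall>x y. (x, y) \<in> ecl (R_face A) \<longrightarrow> u $ x = u $ y) \<and> u $ d0 = 0}"
  \<comment> \<open>\<open>u $ d\<close> is the value at the face on the right of \<open>d\<close>,
    so the face on its left has the value \<open>u $ flip F d\<close>.\<close>
  define L :: "real ^ 'd \<Rightarrow> real ^ 'd" where "L u = (\<chi> d. u $ flip F d - u $ d)" for u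
  have W_iff: "u \<in> ?W \<longleftrightarrow> (\<forall>d. u $ flip F (rot F d) = u $ d) \<and>
      (\<forall>d. edge_at F d \<notin> A \<longrightarrow> u $ flip F d = u $ d) \<and> u $ d0 = 0" (is "_ \<longleftrightarrow> ?P u") for u
  proof
    assume "u \<in> ?W"
    then have u: "(x, y) \<in> ecl (R_face A) \<Longrightarrow> u $ x = u $ y" "u $ d0 = 0" for x y by auto
    show "?P u"
    proof (intro conjI allI impI)
      show "u $ flip F (rot F d) = u $ d" for d
        by (rule u(1)[symmetric], rule ecl_base) simp
      show "u $ flip F d = u $ d" if "edge_at F d \<notin> A" for d
        by (rule u(1)[symmetric], rule ecl_base) (simp add: flip_on_edge that)
    qed (rule u(2))
  next
    assume P: "?P u"
    have "u $ x = u $ y" if "(x, y) \<in> ecl (R_face A)" for x y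
      by (rule ecl_invariant[OF that]) (use P in \<open>auto simp: flip_on_edge split: if_splits\<close>)
    then show "u \<in> ?W" using P by simp
  qed
  have lin: "linear L" by (rule linearI) (auto simp: L_def vec_eq_iff algebra_simps)
  have sub: "subspace ?W" by (rule subspaceI) auto
  have "inj_on L ?W"
  proof -
    have "u = 0" if "u \<in> ?W" "L u = 0" for u
    proof -
      have f: "u $ flip F d = u $ d" for d using that(2) by (simp add: L_def vec_eq_iff)
      have r: "u $ rot F d = u $ d" for d using f[of "rot F d"] that(1) W_iff by simp
      have "u $ d = u $ d0" for d
        by (rule ecl_invariant[OF connected]) (use f r in auto)
      then show "u = 0" using that(1) by (simp add: vec_eq_iff)
    qed
    then show ?thesis using linear_injective_on_subspace_0[OF lin sub] by blast
  qed
  then have "inj_on L (span ?W)" by (simp add: span_eq_iff[THEN iffD2, OF sub])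
  then have "dim (L ` ?W) = dim ?W" by (rule dim_image_eq[OF lin])
  moreover have "L ` ?W = {z \<in> boundaries F. \<forall>d. edge_at F d \<notin> A \<longrightarrow> z $ d = 0}"
  proof (intro set_eqI iffI)
    fix z assume "z \<in> L ` ?W"
    then obtain u where z: "z = L u" and "u \<in> ?W" by blast
    then have u: "?P u" using W_iff by blast
    have face: "u $ flip F x = u $ flip F y" if "face_at F x = face_at F y" for x y
    proof -
      have "(flip F x, flip F y) \<in> ecl (graph_of (flip F \<circ> rot F))"
        using that face_at_flip_eq_iff[of "flip F x" "flip F y"] by simp
      then show ?thesis by (rule ecl_invariant) (use u in simp)
    qed
    \<comment> \<open>Reads the value of a face off any dart that has it on its left; by
      \<open>face\<close> the choice does not matter.\<close>
    define w where "w c = u $ flip F (SOME x. c = face_at F x)" for c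
    have "w (face_at F d) = u $ flip F d" for d
      unfolding w_def by (rule face[symmetric]) (rule someI[of _ d], simp)
    then have "z \<in> boundaries F" unfolding boundaries_iff
      by (intro exI[of _ w]) (simp add: z L_def)
    then show "z \<in> {z \<in> boundaries F. \<forall>d. edge_at F d \<notin> A \<longrightarrow> z $ d = 0}"
      using u by (simp add: z L_def)
  next
    fix z assume "z \<in> {z \<in> boundaries F. \<forall>d. edge_at F d \<notin> A \<longrightarrow> z $ d = 0}"
    then have "z \<in> boundaries F" and z: "\<And>d. edge_at F d \<notin> A \<Longrightarrow> z $ d = 0" by auto
    then obtain w where w: "\<And>d. z $ d = w (face_at F d) - w (face_at F (flip F d))"
      unfolding boundaries_iff by metis
    define u :: "real ^ 'd" where "u = (\<chi> d. w (face_at F (flip F d)) - w (face_at F (flip F d0)))"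
    have "w (face_at F (flip F d)) = w (face_at F d)" if "edge_at F d \<notin> A" for d
      using w[of d] z[OF that] by simp
    then have "u \<in> ?W" unfolding W_iff by (simp add: u_def)
    moreover have "z = L u" by (simp add: vec_eq_iff L_def u_def w)
    ultimately show "z \<in> L ` ?W" by blast
  qed
  ultimately show ?thesis
    using dim_class_functions[of "R_face A" d0] unfolding ker_dim_def kernel_eq by simp
qed

end

section \<open>Genera of a neighbourhood and its complement\<close>

lemma card_Un3_disjoint:
  assumes "finite X" "finite Y" "finite Z" "X \<inter> Y = {}" "X \<inter> Z = {}" "Y \<inter> Z = {}"
  shows "card (X \<union> Y \<union> Z) = card X + card Y + card Z"
  using assms by (simp add: card_Un_disjoint Int_Un_distrib2)

text \<open>A vertex outside \<open>V\<close> is a class of its own, so every relation of this kind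
  has the same surplus. It is stated for a general \<open>R\<close> to serve both
  \<open>R_vert\<close> and \<open>R_bd\<close>.\<close>

lemma outer_orbits:
  fixes F :: "('d::finite) surface"
  assumes "surface_map F" "V \<subseteq> range (vertex_at F)"
    and saturated: "\<And>x y. (x, y) \<in> R \<Longrightarrow> vertex_at F x \<in> V \<longleftrightarrow> vertex_at F y \<in> V"
    and inside: "\<And>x y. (x, y) \<in> R \<Longrightarrow> vertex_at F x \<notin> V \<Longrightarrow> vertex_at F y = vertex_at F x"
    and rot: "\<And>x. vertex_at F x \<notin> V \<Longrightarrow> (x, rot F x) \<in> ecl R"
  shows "classes R = card ({d. vertex_at F d \<in> V} // ecl R) + card (range (vertex_at F) - V)"
proof -
  interpret surface_map F by fact
  have cl: "ecl R `` {d} = vertex_at F d" if d: "vertex_at F d \<notin> V" for d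
  proof
    show "ecl R `` {d} \<subseteq> vertex_at F d"
    proof clarify
      fix x assume dx: "(d, x) \<in> ecl R"
      \<comment> \<open>Constant along \<open>R\<close>: it names the vertex of a dart outside
        \<open>V\<close> and lumps all darts at \<open>V\<close> together.\<close>
      let ?h = "\<lambda>x. if vertex_at F x \<in> V then None else Some (vertex_at F x)"
      have "?h d = ?h x"
        by (rule ecl_invariant[OF dx]) (use saturated inside in auto)
      then show "x \<in> vertex_at F d" using d by (auto simp: in_vertex_at_iff split: if_splits)
    qed
    show "vertex_at F d \<subseteq> ecl R `` {d}"
    proof
      fix x assume "x \<in> vertex_at F d"
      then obtain n where x: "x = (rot F ^^ n) d"
        by (auto simp: vertex_at_class ecl_graph_iff[OF inj_rot])
      have "(d, (rot F ^^ n) d) \<in> ecl R \<and> vertex_at F ((rot F ^^ n) d) = vertex_at F d"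
      proof (induction n)
        case (Suc n)
        then have "((rot F ^^ n) d, (rot F ^^ Suc n) d) \<in> ecl R" using rot d by simp
        with Suc show ?case by (auto intro: ecl_trans[of d "(rot F ^^ n) d"])
      qed simp
      then show "x \<in> ecl R `` {d}" using x by simp
    qed
  qed
  have "(- {d. vertex_at F d \<in> V}) // ecl R = (\<lambda>d. ecl R `` {d}) ` {d. vertex_at F d \<notin> V}"
    by (auto simp: quotient_def)
  also have "\<dots> = vertex_at F ` {d. vertex_at F d \<notin> V}"
    by (rule image_cong) (use cl in auto)
  also have "\<dots> = range (vertex_at F) - V" by auto
  finally show ?thesis
    using classes_split[of R "{d. vertex_at F d \<in> V}"] saturated by simp
qed

context surface_map
begin

lemma card_darts: "CARD('d) = 2 * card (range (edge_at F))"
  using card_darts_on_edges[of "range (edge_at F)"] by simp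

lemma face_class_count: "classes (R_face {}) = 1"
proof (rule classes_eq_1)
  fix x y
  have "graph_of (rot F) \<union> graph_of (flip F) \<subseteq> ecl (R_face {})"
  proof -
    have f: "(d, flip F d) \<in> ecl (R_face {})" for d
      by (rule ecl_base) (simp add: flip_on_edge)
    moreover have "(d, rot F d) \<in> ecl (R_face {})" for d
    proof -
      have "(d, flip F (rot F d)) \<in> ecl (R_face {})" by (rule ecl_base) simp
      then show ?thesis using ecl_trans f[of "flip F (rot F d)"] by fastforce
    qed
    ultimately show ?thesis by auto
  qed
  from ecl_least[OF this] show "(x, y) \<in> ecl (R_face {})" using connected by blast
qed

end

context embedded_subgraph
begin

definition "outer = card (range (vertex_at F) - V)"

lemma card_outer: "int outer = int (card (range (vertex_at F))) - int (card V)"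
  unfolding outer_def using V_sub by (simp add: card_Diff_subset of_nat_diff card_mono)

lemma classes_vert: "classes (R_vert A) = graph_components F V A + outer"
  unfolding graph_components_classes outer_def
proof (rule outer_orbits[OF surface_map_axioms V_sub])
  fix x y assume xy: "(x, y) \<in> R_vert A"
  show "vertex_at F x \<in> V \<longleftrightarrow> vertex_at F y \<in> V" using R_vert_closed[OF xy] by simp
  show "vertex_at F x \<notin> V \<Longrightarrow> vertex_at F y = vertex_at F x"
    using xy vertex_in by (auto simp: flip_on_edge split: if_splits)
qed (auto intro: ecl_base)

lemma classes_bd: "classes (R_bd A) = boundary_circles F N + outer"
  unfolding boundary_circles_nbhd outer_def
proof (rule outer_orbits[OF surface_map_axioms V_sub])
  have out: "flip_on (flip F) A (rot F x) = rot F x" if "vertex_at F x \<notin> V" for x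
    using that vertex_in[of "rot F x"] by (auto simp: flip_on_edge)
  show "(x, rot F x) \<in> ecl (R_bd A)" if "vertex_at F x \<notin> V" for x
    by (rule ecl_base) (simp add: out[OF that])
  fix x y assume xy: "(x, y) \<in> R_bd A"
  show "vertex_at F x \<in> V \<longleftrightarrow> vertex_at F y \<in> V" using R_bd_closed[OF xy] by simp
  show "vertex_at F x \<notin> V \<Longrightarrow> vertex_at F y = vertex_at F x"
    using xy out by simp
qed

lemma card_N: "card N = card V + card A"
  unfolding regular_nbhd_def
  by (subst card_Un_disjoint) (auto simp: card_image inj_on_def)

lemma card_tiles:
  "card (tiles F) = card (range (vertex_at F)) + card (range (edge_at F)) + card (range (face_at F))"
proof -
  have "tiles F = Vertex ` range (vertex_at F) \<union> Edge ` range (edge_at F) \<union> Face ` range (face_at F)"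
    by (simp add: tiles_def image_comp)
  also have "card \<dots> = card (range (vertex_at F)) + card (range (edge_at F)) + card (range (face_at F))"
    by (subst card_Un3_disjoint) (auto simp: card_image inj_on_def)
  finally show ?thesis .
qed

lemma N_sub_tiles: "N \<subseteq> tiles F"
  using V_sub A_sub by (auto simp: regular_nbhd_def)

lemma tiles_at_side_sub: "tiles_at_side F s \<subseteq> tiles F"
  by (cases s) auto

text \<open>Each dart at \<open>V\<close> accounts for two corners, one band end and one arc, which
  cancel. Each edge of \<open>A\<close> adds two long sides and one tile.\<close>

lemma euler_char_nbhd: "euler_char F N = int (card V) - int (card A)"
proof -
  have "{c. tiles_at_corner F c \<inter> N \<noteq> {}} = D_V \<times> UNIV"
    using vertex_in by auto
  then have c: "card {c. tiles_at_corner F c \<inter> N \<noteq> {}} = 2 * card D_V"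
    by (simp add: card_cartesian_product)
  have "{s. tiles_at_side F s \<inter> N \<noteq> {}} = VE ` D_V \<union> EF ` {d. edge_at F d \<in> A} \<union> VF ` D_V"
  proof (rule set_eqI)
    show "s \<in> {s. tiles_at_side F s \<inter> N \<noteq> {}} \<longleftrightarrow> s \<in> VE ` D_V \<union> EF ` {d. edge_at F d \<in> A} \<union> VF ` D_V" for s
      using vertex_in by (cases s) auto
  qed
  also have "card \<dots> = 2 * card D_V + 2 * card A"
    by (subst card_Un3_disjoint) (auto simp: card_image inj_on_def card_darts_on_edges[OF A_sub])
  finally have "card {s. tiles_at_side F s \<inter> N \<noteq> {}} = 2 * card D_V + 2 * card A" .
  then show ?thesis unfolding euler_char_def c card_N by simp
qed

text \<open>Corners, long sides and arcs always meet a face tile. A band end meets the complement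
  exactly if its edge is not in \<open>A\<close>, because an edge of \<open>A\<close> has its ends
  in \<open>V\<close>.\<close>

lemma euler_char_complement:
  "euler_char F (tiles F - N) =
     int (card (range (face_at F))) - int (card (range (edge_at F))) + int (card A) + int outer"
proof -
  have "tiles_at_corner F c \<inter> (tiles F - N) \<noteq> {}" for c
  proof -
    have "Face (face_at F (if snd c then fst c else flip F (fst c))) \<in> tiles_at_corner F c \<inter> (tiles F - N)"
      by (cases c) simp
    then show ?thesis by blast
  qed
  then have "{c. tiles_at_corner F c \<inter> (tiles F - N) \<noteq> {}} = UNIV" by simp
  then have c: "card {c. tiles_at_corner F c \<inter> (tiles F - N) \<noteq> {}} = 2 * CARD('a)" by simp
  have "{s. tiles_at_side F s \<inter> (tiles F - N) \<noteq> {}} = VE ` (- {d. edge_at F d \<in> A}) \<union> range EF \<union> range VF"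
  proof (rule set_eqI)
    show "s \<in> {s. tiles_at_side F s \<inter> (tiles F - N) \<noteq> {}} \<longleftrightarrow>
        s \<in> VE ` (- {d. edge_at F d \<in> A}) \<union> range EF \<union> range VF" for s
      using vertex_in by (cases s) auto
  qed
  also have "card \<dots> = card (- {d. edge_at F d \<in> A}) + 2 * CARD('a)"
    by (subst card_Un3_disjoint) (auto simp: card_image inj_on_def)
  also have "card (- {d. edge_at F d \<in> A}) = CARD('a) - 2 * card A"
    by (subst Compl_eq_Diff_UNIV) (simp add: card_Diff_subset card_darts_on_edges[OF A_sub])
  finally have "card {s. tiles_at_side F s \<inter> (tiles F - N) \<noteq> {}} = CARD('a) - 2 * card A + 2 * CARD('a)" .
  moreover have "card (tiles F - N) = card (tiles F) - card N" "card N \<le> card (tiles F)"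
    using N_sub_tiles by (auto simp: card_Diff_subset card_mono tiles_def regular_nbhd_def)
  moreover have "card A \<le> card (range (edge_at F))" using A_sub by (simp add: card_mono)
  ultimately show ?thesis
    unfolding euler_char_def c using card_darts card_outer card_N card_tiles by simp
qed

lemma boundary_circles_complement: "boundary_circles F (tiles F - N) = boundary_circles F N"
proof -
  have "boundary_sides F (tiles F - N) = boundary_sides F N"
    unfolding boundary_sides_def using tiles_at_side_sub by fast
  then show ?thesis by (simp add: boundary_circles_def)
qed

text \<open>Take the graph whose nodes are the components on both sides and whose edges are the
  boundary circles. It is connected because the surface is, so it has at most one node more than
  edges. In terms of relations, \<open>R_bd\<close> is finer than both others, which together relate
  all darts, and semimodularity yields the count.\<close>

lemma components_bound: "classes (R_vert A) + classes (R_face A) \<le> classes (R_bd A) + 1"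
proof -
  have "R_bd A \<subseteq> ecl (R_vert A)"
  proof clarify
    fix x y assume y: "(x, y) \<in> R_bd A"
    have "(x, rot F x) \<in> ecl (R_vert A)" "(rot F x, y) \<in> ecl (R_vert A)"
      using y by (auto intro: ecl_base)
    then show "(x, y) \<in> ecl (R_vert A)" by (rule ecl_trans)
  qed
  moreover have "R_vert A \<subseteq> ecl (R_vert A)" by (auto intro: ecl_base)
  ultimately have "ecl (R_bd A \<union> R_vert A) \<subseteq> ecl (R_vert A)" by (intro ecl_least) simp
  then have 1: "classes (R_vert A) \<le> classes (R_bd A \<union> R_vert A)" by (rule classes_antimono)
  have "R_bd A \<subseteq> ecl (R_face A)"
  proof clarify
    fix x y assume "(x, y) \<in> R_bd A"
    then have y: "y = flip_on (flip F) (range (edge_at F) - A) (flip F (rot F x))"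
      by (simp add: flip_on_edge)
    have "(x, flip F (rot F x)) \<in> ecl (R_face A)" "(flip F (rot F x), y) \<in> ecl (R_face A)"
      unfolding y by (rule ecl_base, simp)+
    then show "(x, y) \<in> ecl (R_face A)" by (rule ecl_trans)
  qed
  then have 2: "ecl (R_bd A) \<subseteq> ecl (R_face A)" by (rule ecl_least)
  have "graph_of (rot F) \<union> graph_of (flip F) \<subseteq> ecl (R_face A \<union> R_vert A)"
    by (auto simp: flip_on_edge intro!: ecl_base split: if_splits)
  then have "classes (R_face A \<union> R_vert A) = 1"
    using ecl_least connected by (intro classes_eq_1) blast
  then show ?thesis using 1 classes_semimodular[OF 2, of "R_vert A"] by simp
qed

text \<open>The rank of \<open>H\<^sub>1(H) \<rightarrow> H\<^sub>1(F)\<close>.\<close>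

definition image_rank :: int where
  "image_rank = int (card A) - int (ker_dim F A) - (int (card V) - int (graph_components F V A))"

text \<open>Twice the genus of the neighbourhood, as an integer before halving and
  truncation.\<close>

definition excess :: int where
  "excess = 2 * int (graph_components F V A) - int (card V) + int (card A) - int (boundary_circles F N)"

lemma excess_nbhd: "2 * int (tile_components F N) - capped_euler_char F N = excess"
  unfolding capped_euler_char_def euler_char_nbhd excess_def tile_components_nbhd graph_components_classes
  by simp

text \<open>Parity and sign are \<open>genus_even_nonneg\<close> for the rotation
  \<open>rot F\<close>. The upper bound is \<open>components_bound\<close>, since
  \<open>image_rank - excess\<close> is the number of boundary circles minus
  \<open>graph_components F V A\<close> minus \<open>ker_dim F A\<close>.\<close>

lemma excess_bounds: "even excess" "0 \<le> excess" "excess \<le> image_rank"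
proof -
  have "A \<subseteq> range (\<lambda>x. {x, flip F x})" using A_sub by (simp add: edge_at_def[abs_def])
  then have "even (2 * int (classes (R_vert A)) - int (classes (graph_of (rot F))) + int (card A)
      - int (classes (R_bd A))) \<and> 2 * int (classes (R_vert A)) - int (classes (graph_of (rot F)))
      + int (card A) - int (classes (R_bd A)) \<ge> 0"
    by (intro genus_even_nonneg inj_rot) simp_all
  moreover have "2 * int (classes (R_vert A)) - int (classes (graph_of (rot F))) + int (card A)
      - int (classes (R_bd A)) = excess"
    using card_outer classes_vert classes_bd card_vertices by (simp add: excess_def)
  ultimately show "even excess" "0 \<le> excess" by (simp_all only:)
  show "excess \<le> image_rank"
    using components_bound ker_dim_classes[of A] classes_vert classes_bd
    by (simp add: excess_def image_rank_def)
qed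

text \<open>\<open>M\<close> is 2 minus the Euler characteristic of the surface. The dual map has
  the rotation \<open>flip F \<circ> rot F\<close> and the edges outside \<open>A\<close>; its
  boundary permutation is that of the neighbourhood, so \<open>genus_even_nonneg\<close> gives
  parity and sign for the complement.\<close>

lemma coexcess:
  defines "M \<equiv> 2 - int (card (range (vertex_at F))) + int (card (range (edge_at F))) - int (card (range (face_at F)))"
  shows "2 * int (tile_components F (tiles F - N)) - capped_euler_char F (tiles F - N) =
      excess + M - 2 * image_rank"
    and "even (excess + M - 2 * image_rank)" "0 \<le> excess + M - 2 * image_rank"
proof -
  let ?A' = "range (edge_at F) - A"
  show eq: "2 * int (tile_components F (tiles F - N)) - capped_euler_char F (tiles F - N) =
      excess + M - 2 * image_rank"
    unfolding capped_euler_char_def euler_char_complement boundary_circles_complement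
      tile_components_complement ker_dim_classes[symmetric] excess_def image_rank_def M_def
    using card_outer by simp
  have "flip_on (flip F) ?A' \<circ> (flip F \<circ> rot F) = flip_on (flip F) A \<circ> rot F"
    by (auto simp: flip_on_edge fun_eq_iff)
  moreover have "?A' \<subseteq> range (\<lambda>x. {x, flip F x})" by (auto simp: edge_at_def)
  then have "even (2 * int (classes (R_face A)) - int (classes (graph_of (flip F \<circ> rot F))) + int (card ?A')
      - int (classes (graph_of (flip_on (flip F) ?A' \<circ> (flip F \<circ> rot F))))) \<and>
      2 * int (classes (R_face A)) - int (classes (graph_of (flip F \<circ> rot F))) + int (card ?A')
      - int (classes (graph_of (flip_on (flip F) ?A' \<circ> (flip F \<circ> rot F)))) \<ge> 0"
    by (intro genus_even_nonneg inj_compose inj_rot inj_flip) simp_all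
  moreover have "2 * int (classes (R_face A)) - int (classes (graph_of (flip F \<circ> rot F))) + int (card ?A')
      - int (classes (R_bd A)) = excess + M - 2 * image_rank"
  proof -
    have "int (card ?A') = int (card (range (edge_at F))) - int (card A)"
      using A_sub by (simp add: card_Diff_subset card_mono)
    then show ?thesis
      unfolding ker_dim_classes[symmetric] classes_bd excess_def image_rank_def M_def card_faces[symmetric]
      using card_outer by simp
  qed
  ultimately show "even (excess + M - 2 * image_rank)" "0 \<le> excess + M - 2 * image_rank"
    by (simp_all only:)
qed

lemma genus_nbhd: "int (genus F N) = excess div 2"
  unfolding genus_def excess_nbhd using excess_bounds by simp

text \<open>The whole surface is the complement of the empty graph, for which \<open>excess\<close>
  and \<open>image_rank\<close> vanish.\<close>

lemma genus_surface:
  "int (genus F (tiles F)) =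
    (2 - int (card (range (vertex_at F))) + int (card (range (edge_at F))) - int (card (range (face_at F)))) div 2
   \<and> even (2 - int (card (range (vertex_at F))) + int (card (range (edge_at F))) - int (card (range (face_at F))))"
proof -
  interpret E: embedded_subgraph F "{}" "{}"
    by unfold_locales (simp add: embedded_graph_def)
  have "graph_components F {} {} = 0"
    by (simp add: graph_components_def num_components_def quotient_def)
  moreover have "boundary_circles F (regular_nbhd {} {}) = 0"
    by (simp add: boundary_circles_def boundary_sides_def num_components_def quotient_def regular_nbhd_def)
  moreover have "ker_dim F {} = 0" using ker_dim_classes[of "{}"] face_class_count by simp
  ultimately have "E.excess = 0" "E.image_rank = 0"
    by (simp_all add: E.excess_def E.image_rank_def)
  moreover have "tiles F - regular_nbhd {} {} = tiles F" by (simp add: regular_nbhd_def)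
  ultimately show ?thesis using E.coexcess by (simp add: genus_def)
qed

lemma genus_complement:
  "int (genus F (tiles F - N)) = int (genus F (tiles F)) + int (genus F N) - image_rank"
  using coexcess genus_surface excess_bounds unfolding genus_nbhd
  unfolding genus_def by (auto elim!: evenE)

text \<open>If \<open>image_rank\<close> is at most 1, the even number \<open>excess\<close> between
  0 and \<open>image_rank\<close> is 0. Conversely, once the neighbourhood has genus 0, the genus of
  the complement determines \<open>image_rank\<close>.\<close>

lemma genus_pair_iff:
  assumes "r \<in> {0, 1}"
  shows "genus F N = 0 \<and> int (genus F (tiles F - N)) = int (genus F (tiles F)) - r \<longleftrightarrow> image_rank = r"
proof -
  have "genus F N = 0" if "image_rank = r"
  proof -
    have "excess = 0" using that assms excess_bounds by (auto elim!: evenE)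
    then show ?thesis using genus_nbhd by simp
  qed
  then show ?thesis using genus_complement by auto
qed

end

section \<open>Edges modulo boundaries\<close>

context surface_map
begin

lemma homologous_iff: "homologous F z z' \<longleftrightarrow> z - z' \<in> boundaries F"
  by (simp add: homologous_def)

lemma subspace_boundaries: "subspace (boundaries F)"
proof (rule subspaceI)
  show "0 \<in> boundaries F" unfolding boundaries_iff by (intro exI[of _ "\<lambda>_. 0"]) simp
  show "x + y \<in> boundaries F" if xy: "x \<in> boundaries F" "y \<in> boundaries F" for x y
  proof -
    obtain u w where "\<forall>d. x $ d = u (face_at F d) - u (face_at F (flip F d))"
      "\<forall>d. y $ d = w (face_at F d) - w (face_at F (flip F d))"
      using xy unfolding boundaries_iff by blast
    then show ?thesis unfolding boundaries_iff by (intro exI[of _ "\<lambda>c. u c + w c"]) simp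
  qed
  show "a *\<^sub>R x \<in> boundaries F" if xy: "x \<in> boundaries F" for a x
  proof -
    obtain u where "\<forall>d. x $ d = u (face_at F d) - u (face_at F (flip F d))"
      using xy unfolding boundaries_iff by blast
    then show ?thesis unfolding boundaries_iff
      by (intro exI[of _ "\<lambda>c. a * u c"]) (simp add: right_diff_distrib)
  qed
qed

lemma dart_chain_nth: "dart_chain F d $ x = of_bool (x = d) - of_bool (x = flip F d)"
  by (auto simp: dart_chain_def axis_def)

lemma dart_chain_flip: "dart_chain F (flip F d) = - dart_chain F d"
  by (simp add: dart_chain_def)

lemma dart_chain_flip_in_boundaries [simp]:
  "dart_chain F (flip F d) \<in> boundaries F \<longleftrightarrow> dart_chain F d \<in> boundaries F"
  using subspace_neg[OF subspace_boundaries, of "dart_chain F d"]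
    subspace_neg[OF subspace_boundaries, of "- dart_chain F d"] by (auto simp: dart_chain_flip)

text \<open>The indicator function of a level set of a 2-chain jumps by at most one across each edge.\<close>

lemma proportional_chains:
  assumes nontrivial: "dart_chain F d \<notin> boundaries F"
    and proportional: "dart_chain F d - a *\<^sub>R dart_chain F d0 \<in> boundaries F"
  shows "dart_chain F d - dart_chain F d0 \<in> boundaries F \<or> dart_chain F d + dart_chain F d0 \<in> boundaries F"
proof (cases "edge_at F d = edge_at F d0")
  case True
  then have "dart_chain F d0 = dart_chain F d \<or> dart_chain F d0 = - dart_chain F d"
    using edge_at_eq_iff[of d d0] by (auto simp: dart_chain_flip)
  then show ?thesis using subspace_0[OF subspace_boundaries] by auto
next
  case False
  obtain w where w: "(dart_chain F d - a *\<^sub>R dart_chain F d0) $ x = w (face_at F x) - w (face_at F (flip F x))" for x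
    using proportional unfolding boundaries_iff by blast
  \<comment> \<open>The values of \<open>w\<close> on the two faces at \<open>d\<close> differ by 1,
    so this level set contains the left face and not the right one.\<close>
  define w' :: "'d set \<Rightarrow> real" where "w' c = of_bool (w c = w (face_at F d))" for c
  define \<epsilon> where "\<epsilon> = w' (face_at F d0) - w' (face_at F (flip F d0))"
  have ne: "d \<noteq> d0" "d \<noteq> flip F d0" "flip F d \<noteq> d0"
    using False by auto
  have "w (face_at F d) - w (face_at F (flip F d)) = 1"
    unfolding w[symmetric] using ne by (simp add: dart_chain_nth flip_neq[of d, symmetric] del: flip_neq)
  then have jump: "w' (face_at F d) - w' (face_at F (flip F d)) = 1" by (simp add: w'_def)
  have "dart_chain F d + \<epsilon> *\<^sub>R dart_chain F d0 \<in> boundaries F"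
    unfolding boundaries_iff
  proof (intro exI[of _ w'] allI)
    fix x
    consider "x = d" | "x = flip F d" | "x = d0" | "x = flip F d0"
      | "x \<noteq> d" "x \<noteq> flip F d" "x \<noteq> d0" "x \<noteq> flip F d0" by blast
    then show "(dart_chain F d + \<epsilon> *\<^sub>R dart_chain F d0) $ x = w' (face_at F x) - w' (face_at F (flip F x))"
    proof cases
      \<comment> \<open>Away from both edges \<open>w\<close> does not jump, hence neither does a
        function of \<open>w\<close>.\<close>
      case 5
      then have "w (face_at F x) = w (face_at F (flip F x))"
        using w[of x] by (simp add: dart_chain_nth)
      then show ?thesis using 5 by (simp add: dart_chain_nth w'_def)
    qed (use ne jump flip_neq[of d, symmetric] flip_neq[of d0, symmetric] in
        \<open>auto simp: dart_chain_nth \<epsilon>_def simp del: flip_neq\<close>)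
  qed
  moreover have "\<epsilon> \<in> {0, 1, -1}" by (simp add: \<epsilon>_def w'_def)
  ultimately show ?thesis using nontrivial by auto
qed

lemma chain_sum_vertex:
  "(\<Sum>x\<in>vertex_at F u. dart_chain F d $ x) =
     of_bool (vertex_at F d = vertex_at F u) - of_bool (vertex_at F (flip F d) = vertex_at F u)"
  by (simp add: dart_chain_nth sum_subtractf of_bool_def sum.delta in_vertex_at_iff)

lemma trivial_is_loop:
  assumes "dart_chain F d \<in> boundaries F"
  shows "vertex_at F d = vertex_at F (flip F d)"
  using boundary_is_cycle[OF assms, of d] unfolding chain_sum_vertex by (auto split: if_splits)

text \<open>Homologous chains have the same boundary, and the boundary of an edge that is not a loop
  determines its tail and its head.\<close>

lemma homologous_ends:
  assumes "dart_chain F d - dart_chain F d' \<in> boundaries F"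
  shows "if vertex_at F d = vertex_at F (flip F d)
         then vertex_at F d' = vertex_at F (flip F d')
         else vertex_at F d' = vertex_at F d \<and> vertex_at F (flip F d') = vertex_at F (flip F d)"
proof -
  have eq: "of_bool (vertex_at F d = vertex_at F u) - of_bool (vertex_at F (flip F d) = vertex_at F u) =
      (of_bool (vertex_at F d' = vertex_at F u) - of_bool (vertex_at F (flip F d') = vertex_at F u) :: real)" for u
    using boundary_is_cycle[OF assms, of u]
    by (simp add: sum_subtractf chain_sum_vertex)
  show ?thesis
    using eq[of d] eq[of "flip F d"] eq[of d'] by (auto simp: of_bool_def split: if_splits)
qed

text \<open>Reversing a dart negates its chain, so the free choice of orientations becomes a sign;
  the endpoints match by \<open>homologous_ends\<close>.\<close>

lemma parallel_iff:
  "parallel F (edge_at F d) (edge_at F d') \<longleftrightarrow>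
     dart_chain F d - dart_chain F d' \<in> boundaries F \<or> dart_chain F d + dart_chain F d' \<in> boundaries F"
proof
  assume "parallel F (edge_at F d) (edge_at F d')"
  then obtain c c' where "edge_at F d = edge_at F c" "edge_at F d' = edge_at F c'"
    and B: "dart_chain F c - dart_chain F c' \<in> boundaries F"
    unfolding parallel_def homologous_iff by blast
  then have "dart_chain F c \<in> {dart_chain F d, - dart_chain F d}"
    "dart_chain F c' \<in> {dart_chain F d', - dart_chain F d'}"
    using edge_at_eq_iff[of d c] edge_at_eq_iff[of d' c'] by (auto simp: dart_chain_flip)
  then show "dart_chain F d - dart_chain F d' \<in> boundaries F \<or> dart_chain F d + dart_chain F d' \<in> boundaries F"
    using B subspace_neg[OF subspace_boundaries B] by (auto simp: add.commute)
next
  assume "dart_chain F d - dart_chain F d' \<in> boundaries F \<or> dart_chain F d + dart_chain F d' \<in> boundaries F"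
  then obtain c' where c': "edge_at F d' = edge_at F c'" "dart_chain F d - dart_chain F c' \<in> boundaries F"
    by (metis diff_minus_eq_add dart_chain_flip edge_at_flip)
  show "parallel F (edge_at F d) (edge_at F d')"
    unfolding parallel_def homologous_iff
    by (rule exI[of _ d], rule exI[of _ c']) (use c' homologous_ends[OF c'(2)] in blast)
qed

text \<open>There is no cycle condition, so that single edges have chains here; intersecting with
  the boundaries brings it back.\<close>

definition chain_space :: "'d set set \<Rightarrow> (real ^ 'd) set" where
  "chain_space A = {z. (\<forall>d. z $ flip F d = - (z $ d)) \<and> (\<forall>d. edge_at F d \<notin> A \<longrightarrow> z $ d = 0)}"

lemma subspace_chains: "subspace (chain_space A)"
  by (rule subspaceI) (auto simp: chain_space_def)

lemma dart_chain_in_chain_space: "edge_at F d \<in> A \<Longrightarrow> dart_chain F d \<in> chain_space A"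
  by (auto simp: chain_space_def dart_chain_nth split: if_splits)

text \<open>One chosen dart per edge gives an orthogonal basis, as chains of different edges have
  disjoint supports.\<close>

lemma chains_span_dim:
  assumes "A \<subseteq> range (edge_at F)"
  shows "chain_space A \<subseteq> span {dart_chain F d |d. edge_at F d \<in> A}" and "dim (chain_space A) = card A"
proof -
  define dart where "dart e = (SOME d. e = edge_at F d)" for e
  have dart: "edge_at F (dart e) = e" if "e \<in> A" for e
  proof -
    have "\<exists>d. e = edge_at F d" using that assms by blast
    then show ?thesis unfolding dart_def by (metis (mono_tags) someI_ex)
  qed
  let ?B = "(\<lambda>e. dart_chain F (dart e)) ` A"
  have sub: "chain_space A \<subseteq> span ?B"
  proof
    fix z assume z: "z \<in> chain_space A"
    have "z = (\<Sum>e\<in>A. (z $ dart e) *\<^sub>R dart_chain F (dart e))"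
    proof (rule vec_eq_iff[THEN iffD2], rule allI)
      fix x
      have "(\<Sum>e\<in>A. (z $ dart e) *\<^sub>R dart_chain F (dart e)) $ x =
          (\<Sum>e\<in>A. if e = edge_at F x then z $ x else 0)"
        unfolding sum_component
      proof (rule sum.cong)
        fix e assume e: "e \<in> A"
        have n: "dart e \<noteq> flip F (dart e)" using flip_neq[of "dart e"] by metis
        consider "x = dart e" | "x = flip F (dart e)" | "edge_at F x \<noteq> e"
          using dart[OF e] edge_at_eq_iff[of "dart e" x] by auto
        then show "((z $ dart e) *\<^sub>R dart_chain F (dart e)) $ x = (if e = edge_at F x then z $ x else 0)"
        proof cases
          case 1
          then show ?thesis using n dart[OF e] by (simp add: dart_chain_nth)
        next
          case 2
          have "z $ x = - (z $ dart e)" using z 2 by (simp add: chain_space_def)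
          then show ?thesis using n[symmetric] dart[OF e] by (simp add: dart_chain_nth 2)
        next
          case 3
          then have "x \<noteq> dart e" "x \<noteq> flip F (dart e)" using dart[OF e] edge_at_flip by metis+
          then show ?thesis using 3 by (simp add: dart_chain_nth)
        qed
      qed simp
      also have "\<dots> = z $ x" using z by (simp add: sum.delta chain_space_def)
      finally show "z $ x = (\<Sum>e\<in>A. (z $ dart e) *\<^sub>R dart_chain F (dart e)) $ x" by simp
    qed
    also have "\<dots> \<in> span ?B" by (intro span_sum span_scale span_base) auto
    finally show "z \<in> span ?B" .
  qed
  have inB: "?B \<subseteq> {dart_chain F d |d. edge_at F d \<in> A}" using dart by auto
  show "chain_space A \<subseteq> span {dart_chain F d |d. edge_at F d \<in> A}"
    using sub span_mono[OF inB] by (rule subset_trans)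
  have diff: "dart_chain F (dart e) $ dart e' = of_bool (e = e')" if "e \<in> A" "e' \<in> A" for e e'
  proof -
    have "dart e' \<noteq> flip F (dart e)"
    proof
      assume eq: "dart e' = flip F (dart e)"
      then have "edge_at F (dart e') = edge_at F (dart e)" by simp
      then have "e = e'" using that dart by simp
      then show False using eq flip_neq[of "dart e"] by simp
    qed
    moreover have "dart e' = dart e \<longleftrightarrow> e = e'" using that dart by metis
    ultimately show ?thesis by (auto simp: dart_chain_nth)
  qed
  have inj: "inj_on (\<lambda>e. dart_chain F (dart e)) A"
  proof (rule inj_onI)
    fix e e' assume "e \<in> A" "e' \<in> A" "dart_chain F (dart e) = dart_chain F (dart e')"
    then have "of_bool (e = e') = (of_bool (e' = e') :: real)" using diff by metis
    then show "e = e'" by (simp split: if_splits)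
  qed
  show "dim (chain_space A) = card A"
  proof (rule dim_unique)
    show "?B \<subseteq> chain_space A" using dart dart_chain_in_chain_space by auto
    show "independent ?B"
    proof (rule pairwise_orthogonal_independent)
      show "pairwise orthogonal ?B"
      proof (rule pairwise_imageI)
        fix e e' assume e: "e \<in> A" "e' \<in> A" "e \<noteq> e'"
        have "dart_chain F (dart e) $ x * dart_chain F (dart e') $ x = 0" for x
        proof -
          have "dart_chain F (dart e) $ x = 0 \<or> dart_chain F (dart e') $ x = 0"
            using e dart unfolding dart_chain_nth by (metis diff_zero edge_at_flip of_bool_eq(1))
          then show ?thesis by auto
        qed
        then show "orthogonal (dart_chain F (dart e)) (dart_chain F (dart e'))"
          unfolding orthogonal_def inner_vec_def inner_real_def by (intro sum.neutral ballI)
      qed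
      show "0 \<notin> ?B" using diff by force
    qed
    show "card ?B = card A" by (rule card_image[OF inj])
  qed (rule sub)
qed

lemma ker_dim_chains: "ker_dim F A = dim (chain_space A \<inter> boundaries F)"
proof -
  have "{z \<in> cycles F A. homologous F z 0} = chain_space A \<inter> boundaries F"
    unfolding kernel_eq using boundary_antisym by (auto simp: chain_space_def)
  then show ?thesis by (simp add: ker_dim_def)
qed

lemma ker_dim_le:
  assumes "A \<subseteq> range (edge_at F)"
  shows "ker_dim F A \<le> card A"
  unfolding ker_dim_chains chains_span_dim(2)[OF assms, symmetric] by (rule dim_subset) simp

text \<open>Equal dimensions mean that all chains on \<open>A\<close> bound, which can be tested on
  the spanning set of single edges.\<close>

lemma rank_0_iff:
  assumes "A \<subseteq> range (edge_at F)"
  shows "ker_dim F A = card A \<longleftrightarrow> (\<forall>d. edge_at F d \<in> A \<longrightarrow> dart_chain F d \<in> boundaries F)"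
proof
  assume "ker_dim F A = card A"
  then have "chain_space A \<inter> boundaries F = chain_space A"
    unfolding ker_dim_chains chains_span_dim(2)[OF assms, symmetric]
    by (intro subspace_dim_equal subspace_inter subspace_chains subspace_boundaries) auto
  then show "\<forall>d. edge_at F d \<in> A \<longrightarrow> dart_chain F d \<in> boundaries F"
    using dart_chain_in_chain_space by blast
next
  assume "\<forall>d. edge_at F d \<in> A \<longrightarrow> dart_chain F d \<in> boundaries F"
  then have "span {dart_chain F d |d. edge_at F d \<in> A} \<subseteq> boundaries F"
    by (intro span_minimal subspace_boundaries) auto
  then have "chain_space A \<inter> boundaries F = chain_space A"
    using chains_span_dim(1)[OF assms] by blast
  then show "ker_dim F A = card A"
    by (simp add: ker_dim_chains chains_span_dim(2)[OF assms])
qed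

text \<open>Rank one means that the chains on \<open>A\<close> are the bounding ones plus the
  multiples of the nonbounding chain of \<open>d0\<close>. Every edge is then a real multiple of
  \<open>d0\<close> modulo boundaries, and \<open>proportional_chains\<close> turns the factor of a
  nontrivial edge into a sign.\<close>

lemma rank_1_iff:
  assumes A: "A \<subseteq> range (edge_at F)" and d0: "edge_at F d0 \<in> A" "dart_chain F d0 \<notin> boundaries F"
  shows "Suc (ker_dim F A) = card A \<longleftrightarrow>
    (\<forall>d. edge_at F d \<in> A \<longrightarrow> dart_chain F d \<in> boundaries F \<or> parallel F (edge_at F d0) (edge_at F d))"
proof -
  let ?K = "chain_space A \<inter> boundaries F" and ?c = "dart_chain F d0"
  have K: "subspace ?K" by (intro subspace_inter subspace_chains subspace_boundaries)
  have "?c \<notin> span ?K" using d0(2) span_eq_iff[THEN iffD2, OF K] by blast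
  then have dim: "dim (insert ?c ?K) = Suc (ker_dim F A)"
    by (simp add: dim_insert ker_dim_chains)
  have sub: "span (insert ?c ?K) \<subseteq> chain_space A"
    using dart_chain_in_chain_space[OF d0(1)] by (intro span_minimal subspace_chains) auto
  have mem: "z \<in> span (insert ?c ?K) \<longleftrightarrow> (\<exists>a. z - a *\<^sub>R ?c \<in> ?K)" for z
    unfolding span_insert span_eq_iff[THEN iffD2, OF K] by blast
  show ?thesis
  proof
    assume "Suc (ker_dim F A) = card A"
    then have "dim (span (insert ?c ?K)) = dim (chain_space A)"
      using dim chains_span_dim(2)[OF A] by simp
    then have eq: "span (insert ?c ?K) = chain_space A"
      by (intro subspace_dim_equal subspace_span subspace_chains sub) simp
    show "\<forall>d. edge_at F d \<in> A \<longrightarrow> dart_chain F d \<in> boundaries F \<or> parallel F (edge_at F d0) (edge_at F d)"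
    proof (intro allI impI)
      fix d assume "edge_at F d \<in> A"
      then have "dart_chain F d \<in> span (insert ?c ?K)" using dart_chain_in_chain_space eq by blast
      then obtain a where "dart_chain F d - a *\<^sub>R ?c \<in> boundaries F" using mem by blast
      then have "dart_chain F d \<in> boundaries F \<or> dart_chain F d - ?c \<in> boundaries F \<or>
          dart_chain F d + ?c \<in> boundaries F"
        using proportional_chains by blast
      then show "dart_chain F d \<in> boundaries F \<or> parallel F (edge_at F d0) (edge_at F d)"
        unfolding parallel_iff
        using subspace_neg[OF subspace_boundaries, of "dart_chain F d - ?c"] by (auto simp: add.commute)
    qed
  next
    assume par: "\<forall>d. edge_at F d \<in> A \<longrightarrow> dart_chain F d \<in> boundaries F \<or> parallel F (edge_at F d0) (edge_at F d)"
    have "dart_chain F d \<in> span (insert ?c ?K)" if d: "edge_at F d \<in> A" for d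
    proof -
      have "\<exists>a. dart_chain F d - a *\<^sub>R ?c \<in> boundaries F"
        using par[rule_format, OF d] unfolding parallel_iff
      proof (elim disjE)
        assume "dart_chain F d \<in> boundaries F"
        then show ?thesis by (intro exI[of _ 0]) simp
      next
        assume "?c - dart_chain F d \<in> boundaries F"
        then show ?thesis
          using subspace_neg[OF subspace_boundaries, of "?c - dart_chain F d"] by (intro exI[of _ 1]) simp
      next
        assume "?c + dart_chain F d \<in> boundaries F"
        then show ?thesis by (intro exI[of _ "-1"]) (simp add: add.commute)
      qed
      moreover have "dart_chain F d - a *\<^sub>R ?c \<in> chain_space A" for a
        by (intro subspace_diff subspace_scale subspace_chains dart_chain_in_chain_space d d0(1))
      ultimately show ?thesis using mem by blast
    qed
    then have "span {dart_chain F d |d. edge_at F d \<in> A} \<subseteq> span (insert ?c ?K)"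
      by (intro span_minimal subspace_span) auto
    then have "span (insert ?c ?K) = chain_space A" using chains_span_dim(1)[OF A] sub by blast
    then have "dim (insert ?c ?K) = card A" using chains_span_dim(2)[OF A] by (metis dim_span)
    then show "Suc (ker_dim F A) = card A" using dim by simp
  qed
qed

end

section \<open>Coefficients\<close>

text \<open>Integer indices are allowed because the exponent \<open>n - 1\<close> in the theorem is
  -1 when \<open>n = 0\<close>.\<close>

definition pcoeff :: "nat \<Rightarrow> int \<Rightarrow> int" where
  "pcoeff m i = (if i \<ge> 0 then coeff ([:-1, 1:] ^ m) (nat i) else 0)"

text \<open>Iterated addition of \<open>e\<close> stands for the multiple \<open>i\<close> times
  \<open>e\<close>; \<open>lookup_term\<close> evaluates it coordinate by coordinate.\<close>

lemma single_minus_one_power: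
  fixes e :: "int \<times> int \<times> int \<times> int"
  shows "(Poly_Mapping.single e (1::int) - 1) ^ m =
    (\<Sum>i\<le>m. Poly_Mapping.single (((+) e ^^ i) 0) (coeff ([:-1, 1:] ^ m) i))"
proof -
  have pow: "Poly_Mapping.single e (1::int) ^ i = Poly_Mapping.single (((+) e ^^ i) 0) 1" for i
    by (induction i) (simp_all add: mult_single)
  have "(Poly_Mapping.single e (1::int) - 1) ^ m = (Poly_Mapping.single e 1 + (- 1)) ^ m" by simp
  also have "\<dots> = (\<Sum>i\<le>m. of_nat (m choose i) * Poly_Mapping.single e 1 ^ i * (- 1) ^ (m - i))"
    by (rule binomial_ring)
  also have "\<dots> = (\<Sum>i\<le>m. Poly_Mapping.single (((+) e ^^ i) 0) (coeff ([:-1, 1:] ^ m) i))"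
  proof (rule sum.cong)
    fix i assume i: "i \<in> {..m}"
    have a: "of_nat (m choose i) = Poly_Mapping.single (0 :: int \<times> int \<times> int \<times> int) (int (m choose i))"
      by simp
    have b: "(- 1) ^ n = Poly_Mapping.single (0 :: int \<times> int \<times> int \<times> int) ((- 1 :: int) ^ n)" for n
      by (induction n) (simp_all add: single_uminus)
    show "of_nat (m choose i) * Poly_Mapping.single e (1::int) ^ i * (- 1) ^ (m - i) =
        Poly_Mapping.single (((+) e ^^ i) 0) (coeff ([:-1, 1:] ^ m) i)"
      unfolding a b pow mult_single using i by (simp add: coeff_linear_poly_power)
  qed simp
  finally show ?thesis .
qed

text \<open>The four factors involve different indeterminates, so the coefficient is a product.
  Out-of-range indices are absorbed by the default value of \<open>pcoeff\<close>.\<close>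

lemma lookup_term:
  "coeff_XYUV ((mono_XYUV 1 0 0 0 - 1) ^ m * (mono_XYUV 0 1 0 0 - 1) ^ l *
      mono_XYUV 0 0 1 0 ^ s * mono_XYUV 0 0 0 1 ^ t) i j a b =
    pcoeff m i * pcoeff l j * of_bool (int s = a) * of_bool (int t = b)"
proof -
  have it: "((+) ((1, 0, 0, 0) :: int \<times> int \<times> int \<times> int) ^^ n) 0 = (int n, 0, 0, 0 :: int)"
    "((+) ((0, 1, 0, 0) :: int \<times> int \<times> int \<times> int) ^^ n) 0 = (0, int n, 0, 0 :: int)"
    "((+) ((0, 0, 1, 0) :: int \<times> int \<times> int \<times> int) ^^ n) 0 = (0, 0, int n, 0 :: int)"
    "((+) ((0, 0, 0, 1) :: int \<times> int \<times> int \<times> int) ^^ n) 0 = (0, 0, 0, int n :: int)" for n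
    by (induction n) (auto simp: zero_prod_def)
  have pow: "Poly_Mapping.single e (1::int) ^ n = Poly_Mapping.single (((+) e ^^ n) 0) 1"
    for e :: "int \<times> int \<times> int \<times> int" and n
    by (induction n) (simp_all add: mult_single)
  let ?c = "\<lambda>m i. coeff ([:-1, 1:] ^ m) i :: int"
  have collapse: "(\<Sum>i'\<le>m. ?c m i' * of_bool (int i' = i)) = pcoeff m i" for m i
  proof -
    have "(\<Sum>i'\<le>m. ?c m i' * of_bool (int i' = i)) =
        (\<Sum>i'\<le>m. if i' = nat i then ?c m i' * of_bool (i \<ge> 0) else 0)"
      by (rule sum.cong) auto
    also have "\<dots> = (if nat i \<le> m then ?c m (nat i) * of_bool (i \<ge> 0) else 0)"
      by (simp add: sum.delta)
    also have "\<dots> = pcoeff m i"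
      by (auto simp: pcoeff_def degree_linear_power coeff_eq_0)
    finally show ?thesis .
  qed
  have "(mono_XYUV 1 0 0 0 - 1) ^ m * (mono_XYUV 0 1 0 0 - 1) ^ l *
      mono_XYUV 0 0 1 0 ^ s * mono_XYUV 0 0 0 1 ^ t =
      (\<Sum>i'\<le>m. \<Sum>j'\<le>l. Poly_Mapping.single (int i', int j', int s, int t) (?c m i' * ?c l j'))"
    unfolding mono_XYUV_def single_minus_one_power pow it
    unfolding sum_product unfolding sum_distrib_right by (simp add: mult_single)
  then have "coeff_XYUV ((mono_XYUV 1 0 0 0 - 1) ^ m * (mono_XYUV 0 1 0 0 - 1) ^ l *
      mono_XYUV 0 0 1 0 ^ s * mono_XYUV 0 0 0 1 ^ t) i j a b =
      (\<Sum>i'\<le>m. \<Sum>j'\<le>l. (?c m i' * of_bool (int i' = i)) * (?c l j' * of_bool (int j' = j))) *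
      (of_bool (int s = a) * of_bool (int t = b))"
    unfolding sum_distrib_right
    by (auto simp: coeff_XYUV_def lookup_sum lookup_single when_def intro!: sum.cong)
  also have "(\<Sum>i'\<le>m. \<Sum>j'\<le>l. (?c m i' * of_bool (int i' = i)) * (?c l j' * of_bool (int j' = j))) =
      (\<Sum>i'\<le>m. ?c m i' * of_bool (int i' = i)) * (\<Sum>j'\<le>l. ?c l j' * of_bool (int j' = j))"
    by (rule sum_product[symmetric])
  finally show ?thesis unfolding collapse by (simp only: mult.assoc)
qed

lemma pcoeff_top: "pcoeff m (int m) = 1"
  by (simp add: pcoeff_def coeff_linear_poly_power)

lemma pcoeff_beyond: "int m < i \<Longrightarrow> pcoeff m i = 0"
  by (auto simp: pcoeff_def degree_linear_power coeff_eq_0 nat_less_iff)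

text \<open>For \<open>m = 0\<close> the index is -1 and both sides are 0; otherwise this is the
  binomial term with a single factor -1.\<close>

lemma pcoeff_subtop: "pcoeff m (int m - 1) = - int m"
proof (cases m)
  case (Suc n)
  then show ?thesis
    using coeff_linear_poly_power[of n "Suc n" "-1" "1 :: int"] by (simp add: pcoeff_def del: power_Suc)
qed (simp add: pcoeff_def)

lemma sum_power_card_Pow:
  fixes q :: "'a::comm_ring_1"
  assumes "finite A"
  shows "(\<Sum>X\<in>Pow A. q ^ card X) = (1 + q) ^ card A"
  using prod_add[OF assms, of "\<lambda>_. q" "\<lambda>_. 1"] by (simp add: add.commute)

text \<open>The powers of Y - 1 over all subsets of \<open>T\<close> add up to Y^(card T).\<close>

lemma sum_pcoeff_Pow: "finite T \<Longrightarrow> (\<Sum>L\<in>Pow T. pcoeff (card L) (int (card T))) = 1"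
proof -
  assume T: "finite T"
  have "(\<Sum>L\<in>Pow T. pcoeff (card L) (int (card T))) = coeff (\<Sum>L\<in>Pow T. [:-1, 1:] ^ card L) (card T)"
    by (simp add: pcoeff_def coeff_sum)
  also have "\<dots> = coeff ([:0, 1:] ^ card T) (card T)"
    unfolding sum_power_card_Pow[OF T] by (simp add: one_pCons)
  also have "\<dots> = 1" by (simp add: coeff_linear_poly_power)
  finally show ?thesis .
qed

text \<open>Split each set into its part in \<open>T\<close> and its nonempty part in
  \<open>Q\<close>. The parts in \<open>T\<close> sum to Y^(card T), so only the constant term of
  the remaining factor \<open>S\<close> matters. It is 1 because (Y - 1) S = Y^(card Q) - 1.\<close>

lemma sum_pcoeff_class:
  assumes "finite T" "finite Q" "Q \<noteq> {}" "T \<inter> Q = {}"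
  shows "(\<Sum>A\<in>{A. A \<subseteq> T \<union> Q \<and> A - T \<noteq> {}}. pcoeff (card A - 1) (int (card T))) = 1"
proof -
  let ?q = "[:-1, 1:] :: int poly"
  define S where "S = (\<Sum>M\<in>Pow Q - {{}}. ?q ^ (card M - 1))"
  have "?q * S = (\<Sum>M\<in>Pow Q - {{}}. ?q ^ card M)"
    unfolding S_def sum_distrib_left
  proof (rule sum.cong)
    fix M assume "M \<in> Pow Q - {{}}"
    then have "card M > 0" using assms(2) by (auto simp: card_gt_0_iff intro: finite_subset)
    then show "?q * ?q ^ (card M - 1) = ?q ^ card M" by (simp flip: power_Suc)
  qed simp
  also have "\<dots> = (1 + ?q) ^ card Q - 1"
    using sum_power_card_Pow[OF assms(2), of ?q] assms(2) by (simp add: sum_diff1)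
  \<comment> \<open>At 0 the left side is minus the constant term of \<open>S\<close>, and the right
    side is -1 because \<open>Q\<close> is nonempty.\<close>
  finally have "poly (?q * S) 0 = poly ((1 + ?q) ^ card Q - 1) 0" by simp
  moreover have "1 + ?q = [:0, 1:]" by (simp add: one_pCons)
  moreover have "coeff ([:0, 1 :: int:] ^ card Q) 0 = 0"
    using assms(2,3) coeff_linear_poly_power[of 0 "card Q" 0 "1 :: int"] by (simp add: card_gt_0_iff)
  ultimately have S0: "coeff S 0 = 1" by (simp add: poly_0_coeff_0)
  have "bij_betw (\<lambda>(L, M). L \<union> M) (Pow T \<times> (Pow Q - {{}})) {A. A \<subseteq> T \<union> Q \<and> A - T \<noteq> {}}"
    by (rule bij_betw_byWitness[where f' = "\<lambda>A. (A \<inter> T, A \<inter> Q)"]) (use assms(4) in auto)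
  then have "(\<Sum>A\<in>{A. A \<subseteq> T \<union> Q \<and> A - T \<noteq> {}}. pcoeff (card A - 1) (int (card T))) =
      (\<Sum>(L, M)\<in>Pow T \<times> (Pow Q - {{}}). pcoeff (card (L \<union> M) - 1) (int (card T)))"
    by (subst sum.reindex_bij_betw[symmetric], assumption) (simp add: case_prod_beta)
  also have "\<dots> = (\<Sum>(L, M)\<in>Pow T \<times> (Pow Q - {{}}). coeff (?q ^ card L * ?q ^ (card M - 1)) (card T))"
  proof (rule sum.cong)
    fix p assume "p \<in> Pow T \<times> (Pow Q - {{}})"
    then obtain L M where p: "p = (L, M)" and LM: "L \<subseteq> T" "M \<subseteq> Q" "M \<noteq> {}" by auto
    then have "card (L \<union> M) = card L + card M" "card M > 0"
      using assms by (auto intro!: card_Un_disjoint simp: finite_subset card_gt_0_iff)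
    then have "card (L \<union> M) - 1 = card L + (card M - 1)" by simp
    then show "(case p of (L, M) \<Rightarrow> pcoeff (card (L \<union> M) - 1) (int (card T))) =
        (case p of (L, M) \<Rightarrow> coeff (?q ^ card L * ?q ^ (card M - 1)) (card T))"
      by (simp add: p pcoeff_def power_add)
  qed simp
  also have "\<dots> = coeff ((\<Sum>L\<in>Pow T. ?q ^ card L) * S) (card T)"
    unfolding S_def sum_product sum.cartesian_product by (simp add: coeff_sum case_prod_beta)
  also have "\<dots> = coeff (monom 1 (card T) * S) (card T)"
    unfolding sum_power_card_Pow[OF assms(1)] by (simp add: one_pCons monom_altdef)
  also have "\<dots> = 1" by (simp add: coeff_monom_mult S0)
  finally show ?thesis .
qed

section \<open>Component counts for loops and bundles of parallel edges\<close>

lemma (in surface_map) same_ends_related: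
  assumes "{vertex_at F d, vertex_at F (flip F d)} = {vertex_at F d0, vertex_at F (flip F d0)}"
    and base: "(d0, flip F d0) \<in> ecl R" and R: "graph_of (rot F) \<subseteq> R"
  shows "(d, flip F d) \<in> ecl R"
proof -
  have rot: "(x, y) \<in> ecl R" if "vertex_at F x = vertex_at F y" for x y
    using that ecl_mono[OF R] by (auto simp: vertex_at_eq_iff)
  consider "vertex_at F d = vertex_at F d0" "vertex_at F (flip F d0) = vertex_at F (flip F d)"
    | "vertex_at F d = vertex_at F (flip F d0)" "vertex_at F d0 = vertex_at F (flip F d)"
    using assms(1) by (auto simp: doubleton_eq_iff)
  then show ?thesis
  proof cases
    case 1
    show ?thesis by (rule ecl_trans[OF rot[OF 1(1)] ecl_trans[OF base rot[OF 1(2)]]])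
  next
    case 2
    show ?thesis by (rule ecl_trans[OF rot[OF 2(1)] ecl_trans[OF ecl_sym[OF base] rot[OF 2(2)]]])
  qed
qed

context embedded_subgraph
begin

lemma components_le: "graph_components F V A \<le> card V"
proof -
  have "classes (R_vert A) \<le> classes (graph_of (rot F))"
    by (rule classes_antimono, rule ecl_mono) simp
  then show ?thesis using classes_vert card_vertices card_outer by simp
qed

lemma components_loops:
  assumes "\<And>d. edge_at F d \<in> A \<Longrightarrow> vertex_at F d = vertex_at F (flip F d)"
  shows "graph_components F V A = card V"
proof -
  have "ecl (R_vert A) = ecl (graph_of (rot F))"
  proof (rule ecl_eqI)
    show "R_vert A \<subseteq> ecl (graph_of (rot F))"
      using assms by (auto simp: flip_on_edge vertex_at_eq_iff intro: ecl_base)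
  qed (auto intro: ecl_base)
  then have "classes (R_vert A) = classes (graph_of (rot F))" by (simp add: classes_def)
  then show ?thesis using classes_vert card_vertices card_outer by simp
qed

text \<open>All edges that are not loops join the same two vertices, so for connectivity they act
  like the single edge of \<open>d0\<close>.\<close>

lemma components_bundle:
  assumes d0: "edge_at F d0 \<in> A" "vertex_at F d0 \<noteq> vertex_at F (flip F d0)"
    and ends: "\<And>d. edge_at F d \<in> A \<Longrightarrow> vertex_at F d = vertex_at F (flip F d) \<or>
      {vertex_at F d, vertex_at F (flip F d)} = {vertex_at F d0, vertex_at F (flip F d0)}"
  shows "Suc (graph_components F V A) = card V"
proof -
  let ?R = "insert (d0, flip F d0) (graph_of (rot F))"
  have "ecl (R_vert A) = ecl ?R"
  proof (rule ecl_eqI)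
    have "(d, flip F d) \<in> ecl ?R" if d: "edge_at F d \<in> A" for d
    proof (cases "vertex_at F d = vertex_at F (flip F d)")
      case True
      then show ?thesis using ecl_mono[of "graph_of (rot F)" ?R] by (auto simp: vertex_at_eq_iff)
    next
      case False
      have "(d0, flip F d0) \<in> ecl ?R" by (rule ecl_base) simp
      then show ?thesis using ends[OF d] False by (intro same_ends_related[of d d0]) auto
    qed
    then show "R_vert A \<subseteq> ecl ?R" by (auto simp: flip_on_edge intro: ecl_base)
    have "(d0, flip F d0) \<in> ecl (R_vert A)" by (rule ecl_base) (simp add: flip_on_edge d0)
    then show "?R \<subseteq> ecl (R_vert A)" by (auto intro: ecl_base)
  qed
  then have "classes (R_vert A) = classes ?R" by (simp add: classes_def)
  moreover have "Suc (classes ?R) = classes (graph_of (rot F))"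
    by (rule classes_insert_unrelated) (use d0(2) vertex_at_eq_iff in blast)
  ultimately show ?thesis using classes_vert card_vertices card_outer by simp
qed

end

section \<open>Parallelism as an equivalence relation, and loops read off from a dart\<close>

context surface_map
begin

lemma parallel_refl: "parallel F (edge_at F d) (edge_at F d)"
  unfolding parallel_iff using subspace_0[OF subspace_boundaries] by simp

lemma parallel_sym:
  "parallel F (edge_at F d) (edge_at F d') \<Longrightarrow> parallel F (edge_at F d') (edge_at F d)"
  unfolding parallel_iff
  using subspace_neg[OF subspace_boundaries, of "dart_chain F d - dart_chain F d'"]
  by (auto simp: add.commute)

text \<open>With parallelism written by means of a sign, transitivity amounts to multiplying
  signs.\<close>

lemma parallel_trans:
  assumes "parallel F (edge_at F d) (edge_at F d')" "parallel F (edge_at F d') (edge_at F d'')"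
  shows "parallel F (edge_at F d) (edge_at F d'')"
proof -
  have *: "parallel F (edge_at F x) (edge_at F y) \<longleftrightarrow>
      (\<exists>\<epsilon>\<in>{1, -1}. dart_chain F x - \<epsilon> *\<^sub>R dart_chain F y \<in> boundaries F)" for x y
    unfolding parallel_iff by simp
  obtain \<epsilon> \<delta> where s: "\<epsilon> \<in> {1, -1::real}" "\<delta> \<in> {1, -1::real}"
    and B: "dart_chain F d - \<epsilon> *\<^sub>R dart_chain F d' \<in> boundaries F"
      "dart_chain F d' - \<delta> *\<^sub>R dart_chain F d'' \<in> boundaries F"
    using assms unfolding * by blast
  have "dart_chain F d - \<epsilon> *\<^sub>R dart_chain F d' + \<epsilon> *\<^sub>R (dart_chain F d' - \<delta> *\<^sub>R dart_chain F d'') \<in> boundaries F"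
    by (intro subspace_add subspace_scale subspace_boundaries B)
  then have "dart_chain F d - (\<epsilon> * \<delta>) *\<^sub>R dart_chain F d'' \<in> boundaries F"
    by (simp add: algebra_simps)
  moreover have "\<epsilon> * \<delta> \<in> {1, -1}" using s by auto
  ultimately show ?thesis unfolding * by blast
qed

lemma parallel_ends:
  assumes "parallel F (edge_at F d) (edge_at F d')"
  shows "if vertex_at F d = vertex_at F (flip F d) then vertex_at F d' = vertex_at F (flip F d')
    else {vertex_at F d', vertex_at F (flip F d')} = {vertex_at F d, vertex_at F (flip F d)}"
proof -
  consider "dart_chain F d - dart_chain F d' \<in> boundaries F"
    | "dart_chain F d - dart_chain F (flip F d') \<in> boundaries F"
    using assms unfolding parallel_iff by (auto simp: dart_chain_flip)
  then show ?thesis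
  proof cases
    case 1
    show ?thesis using homologous_ends[OF 1] by (simp split: if_splits)
  next
    case 2
    show ?thesis using homologous_ends[OF 2] by (simp add: insert_commute split: if_splits)
  qed
qed

lemma edge_in_loops_iff:
  "edge_at F d \<in> loops F E \<longleftrightarrow> edge_at F d \<in> E \<and> vertex_at F d = vertex_at F (flip F d)"
proof
  assume "edge_at F d \<in> loops F E"
  then obtain c where "edge_at F d = edge_at F c" "edge_at F c \<in> E" "vertex_at F c = vertex_at F (flip F c)"
    unfolding loops_def by blast
  then show "edge_at F d \<in> E \<and> vertex_at F d = vertex_at F (flip F d)"
    using edge_at_eq_iff[of d c] by (metis flip_flip)
qed (auto simp: loops_def)

lemma edge_in_trivial_loops_iff:
  "edge_at F d \<in> trivial_loops F E \<longleftrightarrow> edge_at F d \<in> E \<and> dart_chain F d \<in> boundaries F"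
proof
  assume "edge_at F d \<in> trivial_loops F E"
  then obtain c where c: "edge_at F d = edge_at F c" "edge_at F c \<in> loops F E" "dart_chain F c \<in> boundaries F"
    unfolding trivial_loops_def homologous_iff diff_0_right by blast
  then show "edge_at F d \<in> E \<and> dart_chain F d \<in> boundaries F"
    using edge_at_eq_iff[of d c] unfolding edge_in_loops_iff
    by (metis dart_chain_flip_in_boundaries)
next
  assume d: "edge_at F d \<in> E \<and> dart_chain F d \<in> boundaries F"
  then have "edge_at F d \<in> loops F E" unfolding edge_in_loops_iff using trivial_is_loop by blast
  with d show "edge_at F d \<in> trivial_loops F E"
    unfolding trivial_loops_def homologous_iff diff_0_right by blast
qed

end

section \<open>Spanning subgraphs sorted by rank modulo boundaries\<close>

locale graph_reduction = surface_map F for F :: "('d::finite) surface" +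
  fixes V E E' :: "'d set set"
  assumes graph: "embedded_graph F V E" and reduced: "reduced_edges F E E'"
begin

abbreviation "T \<equiv> trivial_loops F E"
abbreviation "comps A \<equiv> graph_components F V A"

definition parallel_class :: "'d set \<Rightarrow> 'd set set" where
  "parallel_class e = {x \<in> E - T. parallel F e x}"

text \<open>For \<open>e\<close> in \<open>E'\<close> these are the subgraphs of rank one modulo
  boundaries whose nontrivial edges are parallel to \<open>e\<close>.\<close>

definition over_class :: "'d set \<Rightarrow> 'd set set set" where
  "over_class e = {A. A \<subseteq> T \<union> parallel_class e \<and> A - T \<noteq> {}}"

lemma sub_embedded: "A \<subseteq> E \<Longrightarrow> embedded_subgraph F V A"
  by unfold_locales (use graph in \<open>auto simp: embedded_graph_def\<close>)

lemma E_sub: "E \<subseteq> range (edge_at F)"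
  using graph by (simp add: embedded_graph_def)

lemma T_sub: "T \<subseteq> E"
proof
  fix x assume "x \<in> T"
  moreover then obtain d where "x = edge_at F d" unfolding trivial_loops_def by blast
  ultimately show "x \<in> E" using edge_in_trivial_loops_iff by blast
qed

lemma E'_sub: "E' \<subseteq> E - T"
  using reduced by (simp add: reduced_edges_def)

lemma representative: "x \<in> E - T \<Longrightarrow> \<exists>!e. e \<in> E' \<and> parallel F x e"
  using reduced by (simp add: reduced_edges_def)

lemma parallel_sym_E: "x \<in> E \<Longrightarrow> y \<in> E \<Longrightarrow> parallel F x y \<Longrightarrow> parallel F y x"
  using E_sub parallel_sym by blast

lemma parallel_trans_E:
  "x \<in> E \<Longrightarrow> y \<in> E \<Longrightarrow> z \<in> E \<Longrightarrow> parallel F x y \<Longrightarrow> parallel F y z \<Longrightarrow> parallel F x z"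
  using E_sub parallel_trans by blast

lemma parallel_class_self: "e \<in> E' \<Longrightarrow> e \<in> parallel_class e"
  using E'_sub E_sub parallel_refl unfolding parallel_class_def by blast

lemma over_class_sub: "A \<in> over_class e \<Longrightarrow> A \<subseteq> E"
  using T_sub by (auto simp: over_class_def parallel_class_def)

text \<open>A common member would contain a nontrivial edge parallel to both \<open>e\<close> and
  \<open>e'\<close>, against the uniqueness of its representative.\<close>

lemma over_class_disjoint:
  assumes "e \<in> E'" "e' \<in> E'" "e \<noteq> e'"
  shows "over_class e \<inter> over_class e' = {}"
proof (rule ccontr)
  assume "over_class e \<inter> over_class e' \<noteq> {}"
  then obtain A where "A \<in> over_class e" "A \<in> over_class e'" by blast
  then obtain x where x: "x \<in> parallel_class e" "x \<in> parallel_class e'" unfolding over_class_def by blast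
  have "e \<in> E" "e' \<in> E" using assms E'_sub by auto
  then have "parallel F x e" "parallel F x e'" "x \<in> E - T"
    using x parallel_sym_E unfolding parallel_class_def by blast+
  then show False using representative assms by blast
qed

lemma components_mono:
  assumes "A \<subseteq> E"
  shows "comps E \<le> comps A"
proof -
  interpret G: embedded_subgraph F V E by (rule sub_embedded) simp
  interpret H: embedded_subgraph F V A by (rule sub_embedded[OF assms])
  have "R_vert A \<subseteq> ecl (R_vert E)"
    using assms by (auto simp: flip_on_edge subset_iff intro!: ecl_base)
  then have "classes (R_vert E) \<le> classes (R_vert A)"
    by (intro classes_antimono ecl_least)
  then show ?thesis
    using G.classes_vert H.classes_vert G.card_outer H.card_outer by simp
qed

text \<open>Every edge of \<open>E\<close> that is not a loop has the same ends as some edge that is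
  kept. This replaces c(G') by c(G) in \<open>mu\<close>.\<close>

lemma components_reduced: "comps E' = comps E"
proof -
  have sub: "E' \<subseteq> E" using E'_sub by blast
  interpret G: embedded_subgraph F V E by (rule sub_embedded) simp
  interpret H: embedded_subgraph F V E' by (rule sub_embedded[OF sub])
  have "(d, flip F d) \<in> ecl (R_vert E')" if d: "edge_at F d \<in> E" for d
  proof (cases "vertex_at F d = vertex_at F (flip F d)")
    case True
    then show ?thesis
      using ecl_mono[of "graph_of (rot F)" "R_vert E'"] by (auto simp: vertex_at_eq_iff)
  next
    case False
    then have "edge_at F d \<in> E - T"
      using d trivial_is_loop edge_in_trivial_loops_iff by blast
    then obtain e where e: "e \<in> E'" "parallel F (edge_at F d) e" using representative by blast
    then obtain d' where d': "e = edge_at F d'" using E'_sub E_sub by blast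
    have "{vertex_at F d, vertex_at F (flip F d)} = {vertex_at F d', vertex_at F (flip F d')}"
      using parallel_ends[of d d'] e(2) False unfolding d' by simp
    moreover have "(d', flip F d') \<in> ecl (R_vert E')"
      by (rule ecl_base) (use e(1) d' in \<open>simp add: flip_on_edge\<close>)
    ultimately show ?thesis by (rule same_ends_related) simp
  qed
  then have "R_vert E \<subseteq> ecl (R_vert E')"
    by (auto simp: flip_on_edge intro: ecl_base)
  then have "classes (R_vert E') \<le> classes (R_vert E)"
    by (intro classes_antimono ecl_least)
  then show ?thesis
    using components_mono[OF sub] G.classes_vert H.classes_vert G.card_outer H.card_outer by simp
qed

lemma trivial_subgraph:
  assumes "A \<subseteq> T"
  shows "ker_dim F A = card A" and "comps A = card V"
proof -
  have AE: "A \<subseteq> E" using assms T_sub by blast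
  interpret H: embedded_subgraph F V A by (rule sub_embedded[OF AE])
  have B: "dart_chain F d \<in> boundaries F" if "edge_at F d \<in> A" for d
    using that assms edge_in_trivial_loops_iff by blast
  then show "ker_dim F A = card A" using rank_0_iff[OF H.A_sub] by blast
  show "comps A = card V" by (rule H.components_loops) (rule trivial_is_loop[OF B])
qed

text \<open>The edge \<open>e\<close> may be missing from \<open>A\<close>, so a nontrivial edge
  \<open>d0\<close> of \<open>A\<close> serves as base of \<open>rank_1_iff\<close>. Parallel edges
  agree on being loops, so \<open>e\<close> still decides the number of components.\<close>

lemma over_class_subgraph:
  assumes e: "e \<in> E'" and A: "A \<in> over_class e"
  shows "Suc (ker_dim F A) = card A"
    and "e \<in> loops F E' \<Longrightarrow> comps A = card V"
    and "e \<notin> loops F E' \<Longrightarrow> Suc (comps A) = card V"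
proof -
  interpret H: embedded_subgraph F V A by (rule sub_embedded[OF over_class_sub[OF A]])
  obtain d where d: "e = edge_at F d" using e E'_sub E_sub by blast
  have eE: "e \<in> E" using e E'_sub by blast
  obtain x where x: "x \<in> A - T" "x \<in> parallel_class e" using A unfolding over_class_def by blast
  obtain d0 where d0: "x = edge_at F d0" using x E_sub unfolding parallel_class_def by blast
  have xE: "x \<in> E" and par: "parallel F e x" using x(2) by (auto simp: parallel_class_def)
  have nontrivial: "dart_chain F d0 \<notin> boundaries F"
    using x xE edge_in_trivial_loops_iff d0 by blast
  have all: "dart_chain F c \<in> boundaries F \<or> parallel F (edge_at F d0) (edge_at F c)"
    if "edge_at F c \<in> A" for c
  proof (cases "edge_at F c \<in> T")
    case True
    then show ?thesis using edge_in_trivial_loops_iff by blast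
  next
    case False
    then have "edge_at F c \<in> E" "parallel F e (edge_at F c)"
      using that A by (auto simp: over_class_def parallel_class_def)
    then show ?thesis
      using parallel_trans_E[OF xE eE _ parallel_sym_E[OF eE xE par]] d0 by blast
  qed
  show "Suc (ker_dim F A) = card A"
    using rank_1_iff[OF H.A_sub _ nontrivial] x d0 all by blast
  have loop_iff: "e \<in> loops F E' \<longleftrightarrow> vertex_at F d0 = vertex_at F (flip F d0)"
  proof -
    have "e \<in> loops F E' \<longleftrightarrow> vertex_at F d = vertex_at F (flip F d)"
      unfolding d edge_in_loops_iff using e d by simp
    also have "\<dots> \<longleftrightarrow> vertex_at F d0 = vertex_at F (flip F d0)"
      using parallel_ends[of d d0] parallel_ends[of d0 d] par parallel_sym_E[OF eE xE par]
      unfolding d d0 by (auto split: if_splits)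
    finally show ?thesis .
  qed
  have ends: "vertex_at F c = vertex_at F (flip F c) \<or>
      \<not> vertex_at F d0 = vertex_at F (flip F d0) \<and>
      {vertex_at F c, vertex_at F (flip F c)} = {vertex_at F d0, vertex_at F (flip F d0)}"
    if "edge_at F c \<in> A" for c
    using all[OF that] trivial_is_loop[of c] parallel_ends[of d0 c] by (meson)
  show "comps A = card V" if "e \<in> loops F E'"
    by (rule H.components_loops) (use ends that loop_iff in blast)
  show "Suc (comps A) = card V" if "e \<notin> loops F E'"
  proof (rule H.components_bundle)
    show "edge_at F d0 \<in> A" using x(1) d0 by simp
    show "vertex_at F d0 \<noteq> vertex_at F (flip F d0)" using that loop_iff by simp
  qed (use ends in blast)
qed

text \<open>Rank 0 would leave only trivial loops, and rank 1 a single parallel class, which has a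
  representative in \<open>E'\<close>. With both excluded the rank is at least 2.\<close>

lemma other_subgraph:
  assumes A: "A \<subseteq> E" and "\<not> A \<subseteq> T" and not: "\<And>e. e \<in> E' \<Longrightarrow> A \<notin> over_class e"
  shows "ker_dim F A + 2 \<le> card A"
proof -
  interpret H: embedded_subgraph F V A by (rule sub_embedded[OF A])
  obtain x where x: "x \<in> A - T" using assms(2) by blast
  then obtain d0 where d0: "x = edge_at F d0" using A E_sub by blast
  have nontrivial: "dart_chain F d0 \<notin> boundaries F"
    using x A edge_in_trivial_loops_iff d0 by blast
  have "ker_dim F A \<noteq> card A"
    using rank_0_iff[OF H.A_sub] nontrivial x d0 by blast
  moreover have "Suc (ker_dim F A) \<noteq> card A"
  proof
    assume "Suc (ker_dim F A) = card A"
    then have all: "\<forall>d. edge_at F d \<in> A \<longrightarrow> dart_chain F d \<in> boundaries F \<or> parallel F x (edge_at F d)"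
      using rank_1_iff[OF H.A_sub _ nontrivial] x d0 by blast
    obtain e where e: "e \<in> E'" "parallel F x e" using representative x A by blast
    have xE: "x \<in> E" and eE: "e \<in> E" using x A e E'_sub by auto
    have "y \<in> parallel_class e" if y: "y \<in> A - T" for y
    proof -
      obtain d where d: "y = edge_at F d" using y A E_sub by blast
      have "parallel F x y" using all y A edge_in_trivial_loops_iff d by blast
      then have "parallel F e y"
        using parallel_trans_E[OF eE xE _ parallel_sym_E[OF xE eE e(2)]] y A by blast
      then show ?thesis using y A by (auto simp: parallel_class_def)
    qed
    then have "A \<in> over_class e" using x by (auto simp: over_class_def)
    then show False using not e(1) by blast
  qed
  ultimately show ?thesis using ker_dim_le[OF H.A_sub] by simp
qed

lemma sum_over_subgraphs:
  fixes f :: "'d set set \<Rightarrow> int"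
  assumes "\<And>A. A \<subseteq> E \<Longrightarrow> ker_dim F A + 2 \<le> card A \<Longrightarrow> f A = 0"
  shows "(\<Sum>A\<in>Pow E. f A) = (\<Sum>A\<in>Pow T. f A) + (\<Sum>e\<in>E'. \<Sum>A\<in>over_class e. f A)"
proof -
  have "(\<Sum>A\<in>Pow E. f A) = (\<Sum>A\<in>Pow T \<union> (\<Union>e\<in>E'. over_class e). f A)"
  proof (rule sum.mono_neutral_right)
    show "Pow T \<union> (\<Union>e\<in>E'. over_class e) \<subseteq> Pow E"
      using T_sub over_class_sub by blast
    show "\<forall>A\<in>Pow E - (Pow T \<union> (\<Union>e\<in>E'. over_class e)). f A = 0"
    proof
      fix A assume A: "A \<in> Pow E - (Pow T \<union> (\<Union>e\<in>E'. over_class e))"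
      show "f A = 0" by (intro assms other_subgraph) (use A in auto)
    qed
  qed simp
  also have "\<dots> = (\<Sum>A\<in>Pow T. f A) + (\<Sum>A\<in>(\<Union>e\<in>E'. over_class e). f A)"
    by (rule sum.union_disjoint) (auto simp: over_class_def)
  also have "(\<Sum>A\<in>(\<Union>e\<in>E'. over_class e). f A) = (\<Sum>e\<in>E'. \<Sum>A\<in>over_class e. f A)"
    by (rule sum.UNION_disjoint) (use over_class_disjoint in simp_all)
  finally show ?thesis .
qed

definition rank :: "'d set set \<Rightarrow> int" where
  "rank A = int (card A) - int (ker_dim F A) - (int (card V) - int (comps A))"

text \<open>For \<open>r\<close> at most 1, \<open>genus_pair_iff\<close> trades the two conditions
  on genera for one on \<open>rank\<close>.\<close>

lemma krushkal_coeff: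
  assumes "r \<in> {0, 1}"
  shows "coeff_XYUV (krushkal_P F V E) i j 0 (int (genus F (tiles F)) - r) =
    (\<Sum>A\<in>Pow E. pcoeff (comps A - comps E) i * pcoeff (ker_dim F A) j * of_bool (rank A = r))"
proof -
  have "coeff_XYUV (krushkal_P F V E) i j 0 (int (genus F (tiles F)) - r) =
    (\<Sum>A\<in>Pow E. pcoeff (comps A - comps E) i * pcoeff (ker_dim F A) j *
      of_bool (int (genus F (regular_nbhd V A)) = 0) *
      of_bool (int (genus F (tiles F - regular_nbhd V A)) = int (genus F (tiles F)) - r))"
    unfolding krushkal_P_def krushkal_def lookup_term[symmetric]
    by (simp add: coeff_XYUV_def lookup_sum)
  also have "\<dots> = (\<Sum>A\<in>Pow E. pcoeff (comps A - comps E) i * pcoeff (ker_dim F A) j * of_bool (rank A = r))"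
  proof (rule sum.cong)
    fix A assume "A \<in> Pow E"
    then interpret H: embedded_subgraph F V A by (intro sub_embedded) simp
    have "rank A = H.image_rank" by (simp add: rank_def H.image_rank_def)
    then show "pcoeff (comps A - comps E) i * pcoeff (ker_dim F A) j *
        of_bool (int (genus F (regular_nbhd V A)) = 0) *
        of_bool (int (genus F (tiles F - regular_nbhd V A)) = int (genus F (tiles F)) - r) =
      pcoeff (comps A - comps E) i * pcoeff (ker_dim F A) j * of_bool (rank A = r)"
      using H.genus_pair_iff[OF assms] by (auto simp: of_bool_def)
  qed simp
  finally show ?thesis .
qed

lemma sum_over_class:
  assumes "e \<in> E'"
  shows "(\<Sum>A\<in>over_class e. pcoeff (card A - 1) (int (card T))) = 1"
  unfolding over_class_def
  by (rule sum_pcoeff_class) (use parallel_class_self[OF assms] in \<open>auto simp: parallel_class_def\<close>)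

lemma krushkal_coefficients:
  defines "n \<equiv> int (card V) - int (comps E)" and "g \<equiv> int (genus F (tiles F))"
    and "k \<equiv> int (card T)"
  shows "coeff_XYUV (krushkal_P F V E) (n - 1) k 0 g = mu F V E'"
    and "coeff_XYUV (krushkal_P F V E) n k 0 (g - 1) = lambda F E'"
proof -
  \<comment> \<open>\<open>n\<close> as a natural number, for comparison with the truncated
    differences of component counts.\<close>
  define N where "N = card V - comps E"
  have le: "comps E \<le> comps A" "comps A \<le> card V" if "A \<subseteq> E" for A
    using components_mono[OF that] embedded_subgraph.components_le[OF sub_embedded[OF that]] by auto
  have n: "n = int N" using le[of E] by (simp add: n_def N_def)
  \<comment> \<open>A class of edges that are not loops lowers the number of components by one, so
    it exists only if \<open>N > 0\<close>, and then \<open>N - 1\<close> is not truncated.\<close>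
  have ker: "ker_dim F A = card A - 1" "rank A = (if e \<in> loops F E' then 1 else 0)"
    "comps A - comps E = (if e \<in> loops F E' then N else N - 1)" "e \<in> loops F E' \<or> N > 0"
    if "e \<in> E'" "A \<in> over_class e" for e A
    using over_class_subgraph[OF that] le[OF over_class_sub[OF that(2)]]
    by (cases "e \<in> loops F E'"; force simp: rank_def N_def)+
  have loops: "loops F E' \<subseteq> E'" by (auto simp: loops_def)
  have count: "(\<Sum>e\<in>E'. \<Sum>A\<in>over_class e. pcoeff (card A - 1) k * of_bool (P e)) = int (card {e \<in> E'. P e})" for P
  proof -
    have "(\<Sum>e\<in>E'. \<Sum>A\<in>over_class e. pcoeff (card A - 1) k * of_bool (P e)) = (\<Sum>e\<in>E'. of_bool (P e))"
      unfolding k_def sum_distrib_right[symmetric] by (rule sum.cong) (simp_all only: sum_over_class mult_1)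
    then show ?thesis by (simp add: Int_def)
  qed
  have "coeff_XYUV (krushkal_P F V E) (n - 1) k 0 g =
      (\<Sum>A\<in>Pow E. pcoeff (comps A - comps E) (n - 1) * pcoeff (ker_dim F A) k * of_bool (rank A = 0))"
    using krushkal_coeff[of 0] by (simp add: g_def)
  also have "\<dots> = (\<Sum>A\<in>Pow T. pcoeff (comps A - comps E) (n - 1) * pcoeff (ker_dim F A) k * of_bool (rank A = 0)) +
      (\<Sum>e\<in>E'. \<Sum>A\<in>over_class e. pcoeff (comps A - comps E) (n - 1) * pcoeff (ker_dim F A) k * of_bool (rank A = 0))"
  proof (rule sum_over_subgraphs)
    fix A assume A: "A \<subseteq> E" "ker_dim F A + 2 \<le> card A"
    \<comment> \<open>With \<open>rank A = 0\<close> and rank at least 2 modulo boundaries,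
      \<open>card V - comps A\<close> is at least 2, so the power of X is at most
      \<open>n - 2\<close>.\<close>
    have "int (comps A - comps E) < n - 1" if "rank A = 0"
      using that A(2) le[OF A(1)] by (simp add: rank_def n_def)
    then show "pcoeff (comps A - comps E) (n - 1) * pcoeff (ker_dim F A) k * of_bool (rank A = 0) = 0"
      by (auto simp: pcoeff_beyond)
  qed
  \<comment> \<open>Trivial loops join no vertices, so X - 1 occurs to the full power
    \<open>n\<close>, whose subleading coefficient is \<open>- n\<close>.\<close>
  also have "(\<Sum>A\<in>Pow T. pcoeff (comps A - comps E) (n - 1) * pcoeff (ker_dim F A) k * of_bool (rank A = 0)) =
      (\<Sum>A\<in>Pow T. - n * pcoeff (card A) k)"
    by (rule sum.cong) (simp_all add: trivial_subgraph rank_def pcoeff_subtop n flip: N_def)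
  also have "\<dots> = - n" unfolding sum_distrib_left[symmetric] k_def by (simp add: sum_pcoeff_Pow)
  also have "(\<Sum>e\<in>E'. \<Sum>A\<in>over_class e. pcoeff (comps A - comps E) (n - 1) * pcoeff (ker_dim F A) k * of_bool (rank A = 0)) =
      (\<Sum>e\<in>E'. \<Sum>A\<in>over_class e. pcoeff (card A - 1) k * of_bool (e \<notin> loops F E'))"
  proof (intro sum.cong refl)
    fix e A assume e: "e \<in> E'" "A \<in> over_class e"
    have "pcoeff (N - 1) (n - 1) = 1" if "N > 0"
      using pcoeff_top[of "N - 1"] that by (simp add: n of_nat_diff)
    then show "pcoeff (comps A - comps E) (n - 1) * pcoeff (ker_dim F A) k * of_bool (rank A = 0) =
        pcoeff (card A - 1) k * of_bool (e \<notin> loops F E')"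
      using ker[OF e] by auto
  qed
  also have "\<dots> = int (card (E' - loops F E'))" unfolding count by (simp add: set_diff_eq)
  finally show "coeff_XYUV (krushkal_P F V E) (n - 1) k 0 g = mu F V E'"
    by (simp add: mu_def components_reduced n_def)
  have "coeff_XYUV (krushkal_P F V E) n k 0 (g - 1) =
      (\<Sum>A\<in>Pow E. pcoeff (comps A - comps E) n * pcoeff (ker_dim F A) k * of_bool (rank A = 1))"
    using krushkal_coeff[of 1] by (simp add: g_def)
  also have "\<dots> = (\<Sum>A\<in>Pow T. pcoeff (comps A - comps E) n * pcoeff (ker_dim F A) k * of_bool (rank A = 1)) +
      (\<Sum>e\<in>E'. \<Sum>A\<in>over_class e. pcoeff (comps A - comps E) n * pcoeff (ker_dim F A) k * of_bool (rank A = 1))"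
  proof (rule sum_over_subgraphs)
    fix A assume A: "A \<subseteq> E" "ker_dim F A + 2 \<le> card A"
    \<comment> \<open>Now \<open>rank A = 1\<close> leaves \<open>card V - comps A\<close> at least
      1, so the power of X stays below \<open>n\<close>.\<close>
    have "int (comps A - comps E) < n" if "rank A = 1"
      using that A(2) le[OF A(1)] by (simp add: rank_def n_def)
    then show "pcoeff (comps A - comps E) n * pcoeff (ker_dim F A) k * of_bool (rank A = 1) = 0"
      by (auto simp: pcoeff_beyond)
  qed
  also have "(\<Sum>A\<in>Pow T. pcoeff (comps A - comps E) n * pcoeff (ker_dim F A) k * of_bool (rank A = 1)) = 0"
    by (rule sum.neutral) (simp add: trivial_subgraph rank_def)
  \<comment> \<open>A class of loops keeps all components, so X - 1 occurs to the power
    \<open>n\<close> with leading coefficient 1; the other classes have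
    \<open>rank A = 0\<close>.\<close>
  also have "(\<Sum>e\<in>E'. \<Sum>A\<in>over_class e. pcoeff (comps A - comps E) n * pcoeff (ker_dim F A) k * of_bool (rank A = 1)) =
      (\<Sum>e\<in>E'. \<Sum>A\<in>over_class e. pcoeff (card A - 1) k * of_bool (e \<in> loops F E'))"
    by (intro sum.cong refl) (use ker pcoeff_top[of N] n in auto)
  also have "\<dots> = int (card (loops F E'))"
    unfolding count using loops by (simp add: Int_absorb1 flip: Int_def)
  finally show "coeff_XYUV (krushkal_P F V E) n k 0 (g - 1) = lambda F E'"
    by (simp add: lambda_def)
qed

end

theorem theorem2p3:
  fixes F :: "('d::finite) surface" and V E E' :: "'d set set" and g k n :: int
  assumes "closed_surface F"
    and "g = int (genus F (tiles F))" and "g \<ge> 1"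
    and "embedded_graph F V E"
    and "reduced_edges F E E'"
    and "k = int (card (trivial_loops F E))"
    and "n = int (card V) - int (graph_components F V E)"
  shows "coeff_XYUV (krushkal_P F V E) (n - 1) k 0 g = mu F V E' \<and>
         coeff_XYUV (krushkal_P F V E) n k 0 (g - 1) = lambda F E'"
proof -
  interpret graph_reduction F V E E'
    using assms by unfold_locales
  show ?thesis using krushkal_coefficients assms by simp
qed

end
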